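(* Let $p,q\ge 2$ be coprime integers, let $\Gamma=\langle x,y\mid x^p=y^q\rangle$ be the group of the $(p,q)$ torus knot, let $\zeta=x^p=y^q$, and let $a,b$ be integers with $1\le a\le p-1$, $1\le b\le q-1$, $a\equiv b$ modulo $2$. Let $\gamma$ be the closed curve in the $SU(2)$-character variety $\mathcal{X}$ of $\Gamma$ formed by the arc $\overline{A}_{(a,b)}$ together with the subinterval with endpoints $2\cos(c\pi/pq)$ and $2\cos(d\pi/pq)$ of $[-2,2]\cong\mathcal{X}_{red}$, where $c,d\in\{1,\dots,pq-1\}$ are the two solutions of the congruences $c,d\equiv\pm a$ modulo $2p$ and $c,d\equiv\pm b$ modulo $2q$ (signs independent). Then $\nu([\gamma],\zeta)\neq 0$.
   Context: $\mathcal{X}$ is the quotient of the space of representations $\Gamma\to SU(2)$ by conjugation in $SU(2)$. Fix a meridian $\mu\in\Gamma$ and let $A\cong\mathbb{Z}^2$ be the peripheral subgroup containing $\mu$; the central element $\zeta$ lies in $A$. $\mathcal{X}_{red}\subset\mathcal{X}$ is the set of classes of representations with abelian image, identified with $[-2,2]$ by $[\rho]\mapsto\mathrm{Tr}(\rho(\mu))$. $A_{(a,b)}\subset\mathcal{X}$ is the set of classes of irreducible representations (those with nonabelian image) with $\mathrm{Tr}\,\rho(x)=2\cos(a\pi/p)$ and $\mathrm{Tr}\,\rho(y)=2\cos(b\pi/q)$; it is an open arc, the interior of a closed arc $\overline{A}_{(a,b)}\subset\mathcal{X}$ (its closure) whose two endpoints are the points $2\cos(c\pi/pq),2\cos(d\pi/pq)$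 of $\mathcal{X}_{red}\cong[-2,2]$. Definition of $\nu$: let $\mathcal{C}$ be the set of representations $\rho:\Gamma\to SU(2)$ with $\rho(\mu)=\mathrm{diag}(u+iv,\,u-iv)$, $u,v\in\mathbb{R}$, $u^2+v^2=1$, $v\ge 0$. For $\rho\in\mathcal{C}$, $\rho(A)$ consists of diagonal matrices; identify $S^1=\{z\in\mathbb{C}:|z|=1\}$ with the diagonal subgroup of $SU(2)$ via the $(1,1)$ entry. Each class in $\mathcal{X}$ has a representative in $\mathcal{C}$, whose restriction to $A$ is independent of the choice; this gives a continuous map $\mathcal{X}\to\mathrm{Hom}(A,S^1)$. A closed curve $\gamma$ in $\mathcal{X}$ is thus sent to a closed curve $\{\bar\gamma_t\}$ in $\mathrm{Hom}(A,S^1)$, and for $g\in A$, $\nu([\gamma],g)\in\pi_1(S^1)\cong\mathbb{Z}$ is the winding number of the closed path $t\mapsto\bar\gamma_t(g)$ in $S^1$. *)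

theory Defs
  imports
    "HOL-Complex_Analysis.Complex_Analysis"
    "HOL-Algebra.Generated_Groups"
    "HOL-Number_Theory.Cong"
begin

section \<open>Groups given by generators and relations\<close>

text \<open>A letter \<open>(g, True)\<close> stands for the generator \<open>g\<close>, and \<open>(g, False)\<close> for its formal inverse.\<close>

type_synonym 'g word = "('g \<times> bool) list"

inductive word_eq :: "('g word \<times> 'g word) set \<Rightarrow> 'g word \<Rightarrow> 'g word \<Rightarrow> bool"
  for R :: "('g word \<times> 'g word) set"
where
  word_refl: "word_eq R u u"
| word_sym: "word_eq R u v \<Longrightarrow> word_eq R v u"
| word_trans: "word_eq R u v \<Longrightarrow> word_eq R v w \<Longrightarrow> word_eq R u w"
| word_cancel: "word_eq R (u @ [(g, s), (g, \<not> s)] @ v) (u @ v)"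
| word_relation: "(l, r) \<in> R \<Longrightarrow> word_eq R (u @ l @ v) (u @ r @ v)"

definition word_class :: "('g word \<times> 'g word) set \<Rightarrow> 'g word \<Rightarrow> 'g word set" where
  "word_class R u = {w. word_eq R u w}"

definition presented_group :: "('g word \<times> 'g word) set \<Rightarrow> 'g word set monoid" where
  "presented_group R =
     \<lparr>carrier = range (word_class R),
      mult = (\<lambda>A B. \<Union>u\<in>A. \<Union>v\<in>B. word_class R (u @ v)),
      one = word_class R []\<rparr>"

lemma word_class_eq_iff: "word_class R u = word_class R v \<longleftrightarrow> word_eq R u v"
proof
  assume "word_class R u = word_class R v"
  moreover have "v \<in> word_class R v" by (simp add: word_class_def word_refl)
  ultimately have "v \<in> word_class R u" by simp
  then show "word_eq R u v" by (simp add: word_class_def)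
next
  assume uv: "word_eq R u v"
  show "word_class R u = word_class R v"
    using word_trans[OF uv] word_trans[OF word_sym[OF uv]] unfolding word_class_def by auto
qed

lemma word_eq_context: "word_eq R u v \<Longrightarrow> word_eq R (a @ u @ b) (a @ v @ b)"
proof (induction rule: word_eq.induct)
  case (word_cancel u g s v)
  show ?case using word_eq.word_cancel[of R "a @ u" g s "v @ b"] by simp
next
  case (word_relation l r u v)
  then show ?case using word_eq.word_relation[of l r R "a @ u" "v @ b"] by simp
next
  case (word_refl u)
  show ?case by (rule word_eq.word_refl)
next
  case (word_sym u v)
  show ?case by (rule word_eq.word_sym[OF word_sym.IH])
next
  case (word_trans u v w)
  show ?case by (rule word_eq.word_trans[OF word_trans.IH])
qed

lemma word_eq_append: "word_eq R u u' \<Longrightarrow> word_eq R v v' \<Longrightarrow> word_eq R (u @ v) (u' @ v')"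
  using word_eq_context[of R u u' "[]" v] word_eq_context[of R v v' u' "[]"]
    word_trans[of R "u @ v" "u' @ v" "u' @ v'"]
  by simp

lemma presented_group_mult:
  "word_class R u \<otimes>\<^bsub>presented_group R\<^esub> word_class R v = word_class R (u @ v)"
proof -
  have eq: "word_class R (u' @ v') = word_class R (u @ v)"
    if "u' \<in> word_class R u" "v' \<in> word_class R v" for u' v'
  proof -
    have "word_eq R (u @ v) (u' @ v')"
      using that by (intro word_eq_append) (simp_all add: word_class_def)
    then show ?thesis unfolding word_class_eq_iff by (rule word_sym)
  qed
  have "u \<in> word_class R u" "v \<in> word_class R v"
    unfolding word_class_def by (simp_all add: word_refl)
  then have "(\<Union>u'\<in>word_class R u. \<Union>v'\<in>word_class R v. word_class R (u' @ v'))
      = (\<Union>u'\<in>word_class R u. \<Union>v'\<in>word_class R v. word_class R (u @ v))"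
    by (intro SUP_cong refl eq)
  also have "\<dots> = word_class R (u @ v)"
    using \<open>u \<in> word_class R u\<close> \<open>v \<in> word_class R v\<close> by blast
  finally show ?thesis by (simp add: presented_group_def)
qed

lemma word_eq_inverse: "word_eq R (map (\<lambda>(g, s). (g, \<not> s)) (rev u) @ u) []"
proof (induction u)
  case Nil
  then show ?case by (simp add: word_refl)
next
  case (Cons a u)
  obtain g s where a: "a = (g, s)" by force
  have "word_eq R (map (\<lambda>(g, s). (g, \<not> s)) (rev (a # u)) @ a # u)
      (map (\<lambda>(g, s). (g, \<not> s)) (rev u) @ u)"
    using word_cancel[of R "map (\<lambda>(g, s). (g, \<not> s)) (rev u)" g "\<not> s" u] by (simp add: a)
  then show ?case using Cons by (rule word_trans)
qed

lemma group_presented_group: "group (presented_group R)"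
proof (rule groupI)
  fix A assume "A \<in> carrier (presented_group R)"
  then obtain u where A: "A = word_class R u" by (auto simp: presented_group_def)
  have "word_class R (map (\<lambda>(g, s). (g, \<not> s)) (rev u)) \<otimes>\<^bsub>presented_group R\<^esub> A
      = \<one>\<^bsub>presented_group R\<^esub>"
    unfolding A presented_group_mult
    by (simp add: presented_group_def word_class_eq_iff word_eq_inverse)
  then show "\<exists>B\<in>carrier (presented_group R). B \<otimes>\<^bsub>presented_group R\<^esub> A = \<one>\<^bsub>presented_group R\<^esub>"
    by (force simp: presented_group_def)
next
  fix A assume "A \<in> carrier (presented_group R)"
  then obtain u where "A = word_class R u" by (auto simp: presented_group_def)
  moreover have "\<one>\<^bsub>presented_group R\<^esub> = word_class R []" by (simp add: presented_group_def)
  ultimately show "\<one>\<^bsub>presented_group R\<^esub> \<otimes>\<^bsub>presented_group R\<^esub> A = A"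
    by (simp only: presented_group_mult append_Nil)
next
  fix A B assume "A \<in> carrier (presented_group R)" "B \<in> carrier (presented_group R)"
  then obtain u v where "A = word_class R u" "B = word_class R v"
    by (auto simp: presented_group_def)
  moreover have "word_class R w \<in> carrier (presented_group R)" for w
    by (simp add: presented_group_def)
  ultimately show "A \<otimes>\<^bsub>presented_group R\<^esub> B \<in> carrier (presented_group R)"
    by (simp only: presented_group_mult)
next
  fix A B C
  assume "A \<in> carrier (presented_group R)" "B \<in> carrier (presented_group R)"
    "C \<in> carrier (presented_group R)"
  then obtain u v w where "A = word_class R u" "B = word_class R v" "C = word_class R w"
    by (auto simp: presented_group_def)
  then show "A \<otimes>\<^bsub>presented_group R\<^esub> B \<otimes>\<^bsub>presented_group R\<^esub> C
      = A \<otimes>\<^bsub>presented_group R\<^esub> (B \<otimes>\<^bsub>presented_group R\<^esub> C)"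
    by (simp only: presented_group_mult append_assoc)
next
  show "\<one>\<^bsub>presented_group R\<^esub> \<in> carrier (presented_group R)"
    unfolding presented_group_def by simp
qed


section \<open>The group of the torus knot\<close>

datatype torus_gen = Gx | Gy

definition torus_rel :: "nat \<Rightarrow> nat \<Rightarrow> (torus_gen word \<times> torus_gen word) set" where
  "torus_rel p q = {(replicate p (Gx, True), replicate q (Gy, True))}"

definition torus_group :: "nat \<Rightarrow> nat \<Rightarrow> torus_gen word set monoid" where
  "torus_group p q = presented_group (torus_rel p q)"

definition torus_x :: "nat \<Rightarrow> nat \<Rightarrow> torus_gen word set" where
  "torus_x p q = word_class (torus_rel p q) [(Gx, True)]"

definition torus_y :: "nat \<Rightarrow> nat \<Rightarrow> torus_gen word set" where
  "torus_y p q = word_class (torus_rel p q) [(Gy, True)]"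

definition torus_zeta :: "nat \<Rightarrow> nat \<Rightarrow> torus_gen word set" where
  "torus_zeta p q = torus_x p q [^]\<^bsub>torus_group p q\<^esub> p"

lemma group_torus_group: "group (torus_group p q)"
  by (simp add: torus_group_def group_presented_group)

lemma torus_zeta_eq: "torus_zeta p q = torus_y p q [^]\<^bsub>torus_group p q\<^esub> q"
proof -
  interpret group "torus_group p q" by (rule group_torus_group)
  have pow: "word_class (torus_rel p q) [l] [^]\<^bsub>torus_group p q\<^esub> n
      = word_class (torus_rel p q) (replicate n l)" for l n
  proof (induction n)
    case 0
    show ?case by (simp add: torus_group_def presented_group_def)
  next
    case (Suc n)
    then show ?case
      by (simp add: torus_group_def presented_group_mult replicate_append_same)
  qed
  have "word_eq (torus_rel p q) (replicate p (Gx, True)) (replicate q (Gy, True))"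
    using word_relation[of "replicate p (Gx, True)" "replicate q (Gy, True)" "torus_rel p q" "[]" "[]"]
    by (simp add: torus_rel_def)
  then show ?thesis
    by (simp add: torus_zeta_def torus_x_def torus_y_def pow word_class_eq_iff)
qed

text \<open>
  With \<open>s q + r p = 1\<close>, the element \<open>x\<^sup>s y\<^sup>r\<close> is a meridian (it does not depend on the choice of
  \<open>s\<close> and \<open>r\<close>, since \<open>\<zeta>\<close> is central).  The meridians of the knot are its conjugates and, for the
  opposite orientation, the conjugates of its inverse, which are obtained from \<open>s q + r p = -1\<close>.
\<close>

definition torus_meridian :: "nat \<Rightarrow> nat \<Rightarrow> torus_gen word set \<Rightarrow> bool" where
  "torus_meridian p q \<mu> \<longleftrightarrow>
     (\<exists>g\<in>carrier (torus_group p q). \<exists>s r :: int.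
        \<bar>s * int q + r * int p\<bar> = 1 \<and>
        \<mu> = g \<otimes>\<^bsub>torus_group p q\<^esub>
            (torus_x p q [^]\<^bsub>torus_group p q\<^esub> s \<otimes>\<^bsub>torus_group p q\<^esub>
             torus_y p q [^]\<^bsub>torus_group p q\<^esub> r)
            \<otimes>\<^bsub>torus_group p q\<^esub> inv\<^bsub>torus_group p q\<^esub> g)"

text \<open>
  The longitude commuting with \<open>\<mu>\<close> is \<open>\<zeta> \<mu>\<^sup>-\<^sup>p\<^sup>q\<close> or, if \<open>\<mu>\<close> has the opposite orientation,
  \<open>\<zeta> \<mu>\<^sup>p\<^sup>q\<close> (up to inversion), so the peripheral subgroup is generated by \<open>\<mu>\<close> and \<open>\<zeta>\<close>.
\<close>

definition torus_peripheral :: "nat \<Rightarrow> nat \<Rightarrow> torus_gen word set \<Rightarrow> torus_gen word set set" where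
  "torus_peripheral p q \<mu> = generate (torus_group p q) {\<mu>, torus_zeta p q}"


section \<open>The \<open>SU(2)\<close>-character variety\<close>

definition conj_transpose :: "complex^'n^'m \<Rightarrow> complex^'m^'n" where
  "conj_transpose M = (\<chi> i j. cnj (M $ j $ i))"

definition SU2 :: "(complex^2^2) monoid" where
  "SU2 = \<lparr>carrier = {U. U ** conj_transpose U = mat 1 \<and> conj_transpose U ** U = mat 1 \<and> det U = 1},
          mult = (**), one = mat 1\<rparr>"

definition diag2 :: "complex \<Rightarrow> complex \<Rightarrow> complex^2^2" where
  "diag2 z w = vector [vector [z, 0], vector [0, w]]"

type_synonym torus_rep = "torus_gen word set \<Rightarrow> complex^2^2"

text \<open>Representations are extensional, so that equality of functions is equality on \<open>\<Gamma>\<close>.\<close>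

definition torus_reps :: "nat \<Rightarrow> nat \<Rightarrow> torus_rep set" where
  "torus_reps p q = hom (torus_group p q) SU2 \<inter> extensional (carrier (torus_group p q))"

text \<open>The topology of pointwise convergence on \<open>\<Gamma>\<close>.\<close>

definition torus_reps_topology :: "nat \<Rightarrow> nat \<Rightarrow> torus_rep topology" where
  "torus_reps_topology p q =
     subtopology (product_topology (\<lambda>_. euclidean) (carrier (torus_group p q))) (torus_reps p q)"

definition rep_conj :: "nat \<Rightarrow> nat \<Rightarrow> complex^2^2 \<Rightarrow> torus_rep \<Rightarrow> torus_rep" where
  "rep_conj p q U \<rho> = (\<lambda>g\<in>carrier (torus_group p q). U ** \<rho> g ** conj_transpose U)"

definition rep_class :: "nat \<Rightarrow> nat \<Rightarrow> torus_rep \<Rightarrow> torus_rep set" where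
  "rep_class p q \<rho> = {rep_conj p q U \<rho> | U. U \<in> carrier SU2}"

definition quotient_topology :: "'a topology \<Rightarrow> ('a \<Rightarrow> 'b) \<Rightarrow> 'b topology" where
  "quotient_topology T f =
     topology (\<lambda>U. U \<subseteq> f ` topspace T \<and> openin T {x \<in> topspace T. f x \<in> U})"

lemma openin_quotient_topology:
  "openin (quotient_topology T f) U \<longleftrightarrow>
     U \<subseteq> f ` topspace T \<and> openin T {x \<in> topspace T. f x \<in> U}"
proof -
  have "istopology (\<lambda>U. U \<subseteq> f ` topspace T \<and> openin T {x \<in> topspace T. f x \<in> U})"
    unfolding istopology_def
  proof (intro conjI allI impI)
    fix S V
    assume "S \<subseteq> f ` topspace T \<and> openin T {x \<in> topspace T. f x \<in> S}"
      and "V \<subseteq> f ` topspace T \<and> openin T {x \<in> topspace T. f x \<in> V}"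
    moreover have "{x \<in> topspace T. f x \<in> S \<inter> V}
        = {x \<in> topspace T. f x \<in> S} \<inter> {x \<in> topspace T. f x \<in> V}" by auto
    ultimately show "S \<inter> V \<subseteq> f ` topspace T" "openin T {x \<in> topspace T. f x \<in> S \<inter> V}"
      by (auto simp del: Int_iff)
  next
    fix K
    assume K: "\<forall>S\<in>K. S \<subseteq> f ` topspace T \<and> openin T {x \<in> topspace T. f x \<in> S}"
    then show "\<Union>K \<subseteq> f ` topspace T" by blast
    have "{x \<in> topspace T. f x \<in> \<Union>K} = (\<Union>S\<in>K. {x \<in> topspace T. f x \<in> S})" by auto
    then show "openin T {x \<in> topspace T. f x \<in> \<Union>K}" using K by auto
  qed
  then show ?thesis by (simp add: quotient_topology_def topology_inverse')
qed

lemma topspace_quotient_topology: "topspace (quotient_topology T f) = f ` topspace T"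
proof (rule equalityI)
  show "topspace (quotient_topology T f) \<subseteq> f ` topspace T"
    using openin_topspace[of "quotient_topology T f"]
    by (rule openin_quotient_topology[THEN iffD1, THEN conjunct1])
  have "{x \<in> topspace T. f x \<in> f ` topspace T} = topspace T" by auto
  then have "openin (quotient_topology T f) (f ` topspace T)"
    by (simp add: openin_quotient_topology)
  then show "f ` topspace T \<subseteq> topspace (quotient_topology T f)" by (rule openin_subset)
qed

lemma quotient_map_quotient_topology: "quotient_map T (quotient_topology T f) f"
  by (simp add: quotient_map_def topspace_quotient_topology openin_quotient_topology)

definition charvar :: "nat \<Rightarrow> nat \<Rightarrow> torus_rep set topology" where
  "charvar p q = quotient_topology (torus_reps_topology p q) (rep_class p q)"

definition abelian_image :: "nat \<Rightarrow> nat \<Rightarrow> torus_rep \<Rightarrow> bool" where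
  "abelian_image p q \<rho> \<longleftrightarrow>
     (\<forall>g\<in>carrier (torus_group p q). \<forall>h\<in>carrier (torus_group p q). \<rho> g ** \<rho> h = \<rho> h ** \<rho> g)"

definition charvar_red :: "nat \<Rightarrow> nat \<Rightarrow> torus_rep set set" where
  "charvar_red p q = {rep_class p q \<rho> | \<rho>. \<rho> \<in> torus_reps p q \<and> abelian_image p q \<rho>}"

text \<open>
  The part of \<open>\<X>\<^sub>r\<^sub>e\<^sub>d\<close> that corresponds to a subset \<open>J\<close> of \<open>[-2,2]\<close> under the identification
  \<open>[\<rho>] \<mapsto> Tr (\<rho>(\<mu>))\<close>.
\<close>

definition charvar_red_part ::
  "nat \<Rightarrow> nat \<Rightarrow> torus_gen word set \<Rightarrow> real set \<Rightarrow> torus_rep set set" where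
  "charvar_red_part p q \<mu> J =
     {\<xi> \<in> charvar_red p q. \<exists>\<rho>\<in>\<xi>. trace (\<rho> \<mu>) \<in> complex_of_real ` J}"

definition charvar_arc :: "nat \<Rightarrow> nat \<Rightarrow> nat \<Rightarrow> nat \<Rightarrow> torus_rep set set" where
  "charvar_arc p q a b =
     {rep_class p q \<rho> | \<rho>. \<rho> \<in> torus_reps p q \<and> \<not> abelian_image p q \<rho> \<and>
        trace (\<rho> (torus_x p q)) = complex_of_real (2 * cos (real a * pi / real p)) \<and>
        trace (\<rho> (torus_y p q)) = complex_of_real (2 * cos (real b * pi / real q))}"


section \<open>The winding number \<open>\<nu>\<close>\<close>

definition normalized_reps :: "nat \<Rightarrow> nat \<Rightarrow> torus_gen word set \<Rightarrow> torus_rep set" where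
  "normalized_reps p q \<mu> =
     {\<rho> \<in> torus_reps p q. \<exists>u v :: real. u\<^sup>2 + v\<^sup>2 = 1 \<and> v \<ge> 0 \<and>
        \<rho> \<mu> = diag2 (Complex u v) (Complex u (- v))}"

text \<open>
  The map from the character variety to \<open>Hom(A, S\<^sup>1)\<close>.  The value at \<open>g \<in> A\<close> is the
  \<open>(1,1)\<close> entry common to all normalized representatives of the class.
\<close>

definition peripheral_char ::
  "nat \<Rightarrow> nat \<Rightarrow> torus_gen word set \<Rightarrow> torus_rep set \<Rightarrow> torus_gen word set \<Rightarrow> complex" where
  "peripheral_char p q \<mu> \<xi> =
     (\<lambda>g\<in>torus_peripheral p q \<mu>. THE z. \<exists>\<rho>\<in>\<xi> \<inter> normalized_reps p q \<mu>. z = \<rho> g $ 1 $ 1)"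

text \<open>
  Here \<open>\<gamma>\<close> is a closed curve in the character variety, parametrized by \<open>[0,1]\<close>; the value is an
  integer regarded as a complex number.
\<close>

definition torus_nu ::
  "nat \<Rightarrow> nat \<Rightarrow> torus_gen word set \<Rightarrow> (real \<Rightarrow> torus_rep set) \<Rightarrow> torus_gen word set \<Rightarrow> complex" where
  "torus_nu p q \<mu> \<gamma> g = winding_number (\<lambda>t. peripheral_char p q \<mu> (\<gamma> t) g) 0"

end

theory Submission
  imports Defs
begin

text \<open>
  Along \<open>\<gamma>\<close> the value of a normalized representation at the central element \<open>\<zeta>\<close> is a number
  \<open>Z(t)\<close> on the unit circle, and \<open>Z\<close> is explicit on each of the two parts of the curve.

  On the arc, \<open>\<rho>(x)\<close> has eigenvalues \<open>cis (\<plusminus> a \<pi> / p)\<close>, so \<open>\<rho>(\<zeta>) = \<rho>(x)\<^sup>p = (-1)\<^sup>a\<close>.  The trace of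
  \<open>\<rho>(\<zeta>)\<close> is a continuous function of the class, and in \<open>SU(2)\<close> only \<open>\<plusminus>1\<close> have trace \<open>\<plusminus>2\<close>;
  hence \<open>Z = (-1)\<^sup>a\<close> on the closure of the arc as well
  (\<open>closure_charvar_arc_trace\<close>, \<open>peripheral_char_zeta_central\<close>).

  An abelian representation is determined by \<open>\<rho>(\<mu>)\<close>, because it factors through the infinite cyclic
  abelianization, where \<open>x\<close>, \<open>y\<close> and \<open>\<zeta>\<close> are the powers \<open>\<mu>\<^sup>e\<^sup>q\<close>, \<open>\<mu>\<^sup>e\<^sup>p\<close> and \<open>\<mu>\<^sup>e\<^sup>p\<^sup>q\<close> with
  \<open>e = \<plusminus>1\<close>.  If \<open>\<rho>(\<mu>)\<close> has the eigenvalues \<open>cis (\<plusminus> \<theta>)\<close> with \<open>0 \<le> \<theta> \<le> \<pi>\<close>, the class has angle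
  \<open>\<theta>\<close> and value \<open>cis (e p q \<theta>)\<close> at \<open>\<zeta>\<close>; the angle identifies the reducible classes with
  \<open>[0, \<pi>]\<close> (\<open>charvar_red_structure\<close>).  The subinterval in \<open>\<gamma>\<close> corresponds to the angles
  between \<open>c \<pi> / pq\<close> and \<open>d \<pi> / pq\<close>.

  So the loop \<open>Z\<close> runs through \<open>cis (e p q \<theta>)\<close> for \<open>\<theta>\<close> between these two angles and stands still
  at \<open>(-1)\<^sup>a\<close> otherwise.  Since \<open>\<gamma>\<close> is a simple closed curve, it passes the subinterval exactly once and
  monotonically: the set \<open>T\<close> of parameters at which \<open>\<gamma>\<close> is in the subinterval is compact,
  the angle is a homeomorphism from \<open>T\<close> onto an interval (after moving the base point out of
  \<open>T\<close>), and therefore \<open>T\<close> is itself an interval.  As \<open>c\<close> and \<open>d\<close> have the parity of \<open>a\<close>, the value is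
  \<open>(-1)\<^sup>a\<close> at both ends, so \<open>Z\<close> lifts to a continuous angle whose total increase is
  \<open>\<plusminus>(d - c) \<pi> \<noteq> 0\<close> (\<open>winding_number_arc_turn\<close>, \<open>winding_number_loop_turn\<close>).  How
  \<open>\<gamma>\<close> moves inside the closed arc has no effect on \<open>Z\<close>, which is constant there.
\<close>

(* Otherwise every matrix entry also parses as a coefficient of a formal power series. *)
no_notation fps_nth (infixl "$" 75)

section \<open>The winding number of a loop that turns along one arc\<close>

text \<open>
  A compact set of parameters on which \<open>f\<close> is a homeomorphism onto an interval is an interval
  \<open>{l..u}\<close>, and \<open>f\<close> is monotone on it.  Extending \<open>N f\<close> by its values at \<open>l\<close> and \<open>u\<close> gives a
  continuous argument of \<open>Z\<close>, whose total change decides the winding number.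
\<close>

lemma winding_number_arc_turn:
  fixes Z :: "real \<Rightarrow> complex" and f :: "real \<Rightarrow> real"
  assumes T: "compact T" "T \<subseteq> {0..1}" and f: "continuous_on T f" "inj_on f T" "f ` T = {\<alpha>..\<beta>}"
    and "\<alpha> < \<beta>" "N \<noteq> 0"
    and on: "\<And>t. t \<in> T \<Longrightarrow> Z t = cis (N * f t)"
    and off: "\<And>t. t \<in> {0..1} - T \<Longrightarrow> Z t = w"
    and ends: "cis (N * \<alpha>) = w" "cis (N * \<beta>) = w"
  shows "winding_number Z 0 \<noteq> 0"
proof -
  obtain g where g: "homeomorphism T {\<alpha>..\<beta>} f g"
    using homeomorphism_compact[OF T(1) f(1,3,2)] by blast
  then have "T = g ` {\<alpha>..\<beta>}" "continuous_on {\<alpha>..\<beta>} g"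
    by (auto simp: homeomorphism_def)
  then have "connected T" by (metis connected_Icc connected_continuous_image)
  with T(1) obtain l u where T_eq: "T = {l..u}"
    using connected_compact_interval_1[of T] by blast
  have "\<alpha> \<in> f ` T" "\<beta> \<in> f ` T" unfolding f(3) using \<open>\<alpha> < \<beta>\<close> by auto
  then obtain x y where xy: "x \<in> T" "y \<in> T" "f x = \<alpha>" "f y = \<beta>"
    by fast
  then have "x \<noteq> y" using \<open>\<alpha> < \<beta>\<close> by auto
  then have "l < u" using xy unfolding T_eq by auto
  have in_ab: "f t \<in> {\<alpha>..\<beta>}" if "t \<in> T" for t using f(3) that by blast
  have "strict_mono_on T f \<or> strict_antimono_on T f"
    using injective_eq_monotone_map[of T f] f T_eq by auto
  then have "f l \<in> {\<alpha>, \<beta>} \<and> f u \<in> {\<alpha>, \<beta>}"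
  proof
    assume m: "strict_mono_on T f"
    have le: "f r \<le> f s" if "r \<in> T" "s \<in> T" "r \<le> s" for r s
      using monotone_onD[OF m that(1,2)] that(3) by (cases "r = s") auto
    have "f l \<le> f x" "f y \<le> f u"
      by (rule le; use xy \<open>l < u\<close> in \<open>simp add: T_eq\<close>)+
    then show ?thesis
      using xy in_ab[of l] in_ab[of u] \<open>l < u\<close> by (simp add: T_eq)
  next
    assume m: "strict_antimono_on T f"
    have le: "f s \<le> f r" if "r \<in> T" "s \<in> T" "r \<le> s" for r s
      using monotone_onD[OF m that(1,2)] that(3) by (cases "r = s") auto
    have "f y \<le> f l" "f u \<le> f x"
      by (rule le; use xy \<open>l < u\<close> in \<open>simp add: T_eq\<close>)+
    then show ?thesis
      using xy in_ab[of l] in_ab[of u] \<open>l < u\<close> by (simp add: T_eq)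
  qed
  then have fends: "f l \<in> {\<alpha>, \<beta>}" "f u \<in> {\<alpha>, \<beta>}" by auto
  have "f l \<noteq> f u" using f(2) \<open>l < u\<close> inj_onD[of f T l u] unfolding T_eq by auto
  \<comment> \<open>clamping the parameter to \<open>{l..u}\<close> extends \<open>N f\<close> continuously to the line\<close>
  define \<phi> where "\<phi> t = N * f (max l (min u t))" for t
  have "continuous_on {0..1} (\<lambda>t. f (max l (min u t)))"
    using \<open>l < u\<close> by (intro continuous_on_compose2[OF f(1)] continuous_intros) (auto simp: T_eq)
  then have path: "path (\<lambda>t. \<i> * of_real (\<phi> t))"
    unfolding path_def \<phi>_def by (intro continuous_intros)
  have Z: "Z t = cis (\<phi> t)" if "0 \<le> t" "t \<le> 1" for t
  proof (cases "t \<in> T")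
    case True
    then show ?thesis using on[OF True] by (simp add: \<phi>_def T_eq)
  next
    case False
    then have "max l (min u t) \<in> {l, u}" using \<open>l < u\<close> by (auto simp: T_eq)
    then have "cis (\<phi> t) = w" using fends ends unfolding \<phi>_def by auto
    then show ?thesis using off[of t] False that by simp
  qed
  have "winding_number Z 0 = winding_number (exp \<circ> (\<lambda>t. \<i> * of_real (\<phi> t))) 0"
    by (rule winding_number_cong) (simp add: Z cis_conv_exp)
  also have "\<dots> = (\<i> * of_real (\<phi> 1) - \<i> * of_real (\<phi> 0)) / (2 * of_real pi * \<i>)"
    using winding_number_compose_exp[OF path] by (simp add: pathfinish_def pathstart_def)
  finally have "winding_number Z 0 = (\<i> * of_real (\<phi> 1) - \<i> * of_real (\<phi> 0)) / (2 * of_real pi * \<i>)" .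
  moreover have "\<phi> 0 = N * f l" "\<phi> 1 = N * f u"
    using T(2) \<open>l < u\<close> by (auto simp: \<phi>_def T_eq max_def min_def)
  ultimately show ?thesis using \<open>f l \<noteq> f u\<close> \<open>N \<noteq> 0\<close> by auto
qed

text \<open>
  A continuous real function injective on \<open>[0, 1/2]\<close> is monotone there, and on the way back it
  takes all the intermediate values a second time.
\<close>

lemma not_inj_loop:
  fixes f :: "real \<Rightarrow> real"
  assumes f: "continuous_on {0..1} f" "f 0 = f 1"
  shows "\<not> inj_on f {0..<1}"
proof
  assume inj: "inj_on f {0..<1}"
  have "f (1/4) \<noteq> f 0"
    using inj_onD[OF inj, of "1/4" 0] by auto
  have c: "continuous_on {0..1/2} f" "continuous_on {1/2..1} f"
    using f(1) by (auto elim: continuous_on_subset)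
  moreover have "inj_on f {0..1/2}" using inj by (auto elim: inj_on_subset)
  ultimately have "(f 0 < f (1/4) \<and> f (1/4) < f (1/2)) \<or> (f (1/2) < f (1/4) \<and> f (1/4) < f 0)"
    using continuous_inj_imp_mono[of 0 "1/4" "1/2" f] by simp
  then obtain t where t: "1/2 \<le> t" "t \<le> 1" "f t = f (1/4)"
    using IVT'[of f "1/2" "f (1/4)" 1, OF _ _ _ c(2)] IVT2'[of f 1 "f (1/4)" "1/2", OF _ _ _ c(2)] f(2)
    by fastforce
  then have "t \<noteq> 1" using f(2) \<open>f (1/4) \<noteq> f 0\<close> by auto
  then show False using inj_onD[OF inj, of t "1/4"] t by auto
qed

text \<open>
  The version for loops, where \<open>T\<close> may contain the base point and then looks like two intervals.
  As \<open>f\<close> returns to its initial value, it cannot be injective on the whole loop; so some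
  parameter \<open>s\<close> lies outside \<open>T\<close>, and the loop restarted at \<open>s\<close> falls under the previous lemma.
\<close>

lemma winding_number_loop_turn:
  fixes Z :: "real \<Rightarrow> complex" and f :: "real \<Rightarrow> real"
  assumes T: "closed T" "closed T'" "T \<union> T' = {0..1}" "0 \<in> T \<longleftrightarrow> 1 \<in> T"
    and f: "continuous_on {0..1} f" "f 0 = f 1" "inj_on f (T - {1})" "f ` T = {\<alpha>..\<beta>}"
    and "\<alpha> < \<beta>" "N \<noteq> 0" and "Z 0 = Z 1"
    and on: "\<And>t. t \<in> T \<Longrightarrow> Z t = cis (N * f t)"
    and off: "\<And>t. t \<in> T' \<Longrightarrow> Z t = w"
    and ends: "cis (N * \<alpha>) = w" "cis (N * \<beta>) = w"
  shows "winding_number Z 0 \<noteq> 0"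
proof -
  have sub: "T \<subseteq> {0..1}" "T' \<subseteq> {0..1}" using T by blast+
  have "T \<noteq> {0..1}"
  proof
    assume "T = {0..1}"
    then have "T - {1} = {0..<1}" by auto
    then show False using not_inj_loop[OF f(1,2)] f(3) by simp
  qed
  then obtain s where s: "s \<in> {0..1} - T" using sub by blast
  \<comment> \<open>with \<open>s > 0\<close> the reparametrization below never takes the value \<open>0\<close>\<close>
  obtain s where s: "s \<in> {0..1} - T" "0 < s"
  proof (cases "s = 0")
    case True
    then show thesis using s T(4) by (intro that[of 1]) auto
  qed (use s that in auto)
  have "continuous_on (T \<union> T') Z"
  proof (rule continuous_on_closed_Un[OF T(1,2)])
    have "continuous_on T (\<lambda>t. cis (N * f t))"
      using f(1) sub by (intro continuous_intros) (auto elim: continuous_on_subset)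
    then show "continuous_on T Z" by (rule continuous_on_eq) (simp add: on)
    have "continuous_on T' (\<lambda>t. w)" by simp
    then show "continuous_on T' Z" by (rule continuous_on_eq) (simp add: off)
  qed
  then have "path Z" by (simp add: path_def T)
  moreover have "0 \<notin> path_image Z"
  proof
    assume "0 \<in> path_image Z"
    then obtain t where "t \<in> T \<union> T'" "Z t = 0" by (auto simp: path_image_def T)
    then show False using on off ends(1) by (metis Un_iff cis_neq_zero)
  qed
  ultimately have shift: "winding_number Z 0 = winding_number (shiftpath s Z) 0"
    using s \<open>Z 0 = Z 1\<close> by (intro winding_number_shiftpath [symmetric]) (auto simp: pathfinish_def pathstart_def)
  define \<sigma> where "\<sigma> t = (if s + t \<le> 1 then s + t else s + t - 1)" for t
  have shift_eq: "shiftpath s h t = h (\<sigma> t)" for h :: "real \<Rightarrow> 'b::topological_space" and t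
    by (simp add: shiftpath_def \<sigma>_def)
  define S where "S = {t \<in> {0..1}. \<sigma> t \<in> T}"
  \<comment> \<open>the pieces meet at \<open>1 - s\<close>, where \<open>\<sigma>\<close> jumps from \<open>1\<close> to \<open>0\<close>; these points are both in \<open>T\<close> or both outside\<close>
  have "S = ((\<lambda>t. s + t) -` T \<inter> {0..1 - s}) \<union> ((\<lambda>t. s + t - 1) -` T \<inter> {1 - s..1})"
    using s T(4) by (auto simp: S_def \<sigma>_def split: if_splits) (smt (verit))+
  moreover have "closed ((\<lambda>t. s + t) -` T \<inter> {0..1 - s})" "closed ((\<lambda>t. s + t - 1) -` T \<inter> {1 - s..1})"
    by (intro continuous_closed_vimage closed_Int T continuous_intros closed_atLeastAtMost)+
  ultimately have "closed S" using closed_Un by metis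
  then have "compact S"
    unfolding compact_eq_bounded_closed using bounded_subset[of "{0..1}" S] by (force simp: S_def)
  have \<sigma>_T: "\<sigma> t \<in> T - {0}" if "t \<in> S" for t
    using that s by (auto simp: S_def \<sigma>_def)
  have \<sigma>_onto: "\<exists>t'\<in>S. \<sigma> t' = t" if "t \<in> T - {0}" for t
  proof (cases "s \<le> t")
    case True
    with that s sub show ?thesis by (intro bexI[of _ "t - s"]) (auto simp: S_def \<sigma>_def)
  next
    case False
    with that s sub show ?thesis by (intro bexI[of _ "t + 1 - s"]) (auto simp: S_def \<sigma>_def)
  qed
  have "inj_on \<sigma> S"
  proof (rule inj_onI)
    fix t t' assume "t \<in> S" "t' \<in> S" and eq: "\<sigma> t = \<sigma> t'"
    then have "t \<noteq> 0" "t' \<noteq> 0" "t \<in> {0..1}" "t' \<in> {0..1}"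
      using s by (auto simp: S_def \<sigma>_def)
    then show "t = t'" using eq s by (auto simp: \<sigma>_def split: if_splits)
  qed
  moreover have "inj_on f (T - {0})"
  proof (rule inj_onI)
    fix t t' assume t: "t \<in> T - {0}" "t' \<in> T - {0}" "f t = f t'"
    define u where "u r = (if r = 1 then 0 else r)" for r :: real
    have "f (u t) = f (u t')" "u t \<in> T - {1}" "u t' \<in> T - {1}"
      using t f(2) T(4) by (auto simp: u_def)
    then have "u t = u t'" by (rule inj_onD[OF f(3)])
    then show "t = t'" using t by (simp add: u_def split: if_splits)
  qed
  ultimately have inj: "inj_on (f \<circ> \<sigma>) S"
    using \<sigma>_T by (intro comp_inj_on) (auto elim: inj_on_subset)
  have onto: "(f \<circ> \<sigma>) ` S = f ` T"
  proof
    show "(f \<circ> \<sigma>) ` S \<subseteq> f ` T" using \<sigma>_T by auto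
    show "f ` T \<subseteq> (f \<circ> \<sigma>) ` S"
    proof
      fix v assume "v \<in> f ` T"
      then obtain t where t: "t \<in> T" "v = f t" by blast
      obtain t' where t': "t' \<in> T - {0}" "v = f t'"
      proof (cases "t = 0")
        case True
        then show thesis using t T(4) f(2) by (intro that[of 1]) auto
      qed (use t that in auto)
      then show "v \<in> (f \<circ> \<sigma>) ` S" using \<sigma>_onto[of t'] by force
    qed
  qed
  show ?thesis unfolding shift
  proof (rule winding_number_arc_turn)
    show "compact S" by fact
    show "S \<subseteq> {0..1}" by (auto simp: S_def)
    have "path (shiftpath s f)"
      using f s by (intro path_shiftpath) (auto simp: path_def pathfinish_def pathstart_def)
    then show "continuous_on S (f \<circ> \<sigma>)"
      unfolding path_def by (rule continuous_on_eq[OF continuous_on_subset]) (auto simp: S_def shift_eq)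
    show "inj_on (f \<circ> \<sigma>) S" by (rule inj)
    show "(f \<circ> \<sigma>) ` S = {\<alpha>..\<beta>}" using onto f(4) by simp
    show "shiftpath s Z t = cis (N * (f \<circ> \<sigma>) t)" if "t \<in> S" for t
      using that by (simp add: shift_eq S_def on)
    show "shiftpath s Z t = w" if "t \<in> {0..1} - S" for t
    proof -
      have "\<sigma> t \<in> {0..1} - T" using that s by (auto simp: S_def \<sigma>_def)
      then have "\<sigma> t \<in> T'" using T(3) by blast
      then show ?thesis by (simp add: shift_eq off)
    qed
    show "\<alpha> < \<beta>" "N \<noteq> 0" "cis (N * \<alpha>) = w" "cis (N * \<beta>) = w" by fact+
  qed
qed

section \<open>Matrices in \<open>SU(2)\<close>\<close>

lemma mat2_eq_iff:
  fixes A B :: "'a^2^2"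
  shows "A = B \<longleftrightarrow> A$1$1 = B$1$1 \<and> A$1$2 = B$1$2 \<and> A$2$1 = B$2$1 \<and> A$2$2 = B$2$2"
  by (auto simp: vec_eq_iff forall_2)

lemma diag2_nth [simp]:
  "diag2 z w $ 1 $ 1 = z" "diag2 z w $ 1 $ 2 = 0" "diag2 z w $ 2 $ 1 = 0" "diag2 z w $ 2 $ 2 = w"
  by (simp_all add: diag2_def)

lemma mat_2_nth [simp]:
  "(mat k :: 'a::zero^2^2) $ 1 $ 1 = k" "(mat k :: 'a^2^2) $ 1 $ 2 = 0"
  "(mat k :: 'a^2^2) $ 2 $ 1 = 0" "(mat k :: 'a^2^2) $ 2 $ 2 = k"
  by (simp_all add: mat_def)

lemma matmul2_nth: "((A :: 'a::semiring_1^2^2) ** B) $ i $ j = A$i$1 * B$1$j + A$i$2 * B$2$j"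
  by (simp add: matrix_matrix_mult_def sum_2)

lemma conj_transpose_nth: "conj_transpose M $ i $ j = cnj (M $ j $ i)"
  by (simp add: conj_transpose_def)

lemma conj_transpose_mult:
  "conj_transpose (A ** B) = conj_transpose B ** conj_transpose A"
  for A B :: "complex^2^2"
  by (simp add: mat2_eq_iff matmul2_nth conj_transpose_nth algebra_simps)

lemma conj_transpose_conj_transpose [simp]: "conj_transpose (conj_transpose A) = A"
  by (simp add: vec_eq_iff conj_transpose_nth)

lemma det_conj_transpose_2: "det (conj_transpose A) = cnj (det A)" for A :: "complex^2^2"
  by (simp add: det_2 conj_transpose_nth algebra_simps)

lemma trace_2: "trace A = A$1$1 + A$2$2" for A :: "'a::semiring_1^2^2"
  by (simp add: trace_def sum_2)

lemma SU2_simps [simp]: "mult SU2 = (**)" "one SU2 = mat 1"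
  by (simp_all add: SU2_def)

lemma conj_transpose_in_SU2: "U \<in> carrier SU2 \<Longrightarrow> conj_transpose U \<in> carrier SU2"
  by (simp add: SU2_def det_conj_transpose_2)

lemma group_SU2: "group SU2"
proof (rule groupI)
  fix A B assume "A \<in> carrier SU2" "B \<in> carrier SU2"
  then have A: "A ** conj_transpose A = mat 1" "conj_transpose A ** A = mat 1" "det A = 1"
    and B: "B ** conj_transpose B = mat 1" "conj_transpose B ** B = mat 1" "det B = 1"
    by (auto simp: SU2_def)
  have "(A ** B) ** (conj_transpose B ** conj_transpose A) = A ** (B ** conj_transpose B) ** conj_transpose A"
    by (simp only: matrix_mul_assoc)
  moreover have "(conj_transpose B ** conj_transpose A) ** (A ** B) = conj_transpose B ** (conj_transpose A ** A) ** B"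
    by (simp only: matrix_mul_assoc)
  ultimately show "A \<otimes>\<^bsub>SU2\<^esub> B \<in> carrier SU2"
    using A B by (simp add: SU2_def conj_transpose_mult det_mul)
next
  have "conj_transpose (mat 1) = (mat 1 :: complex^2^2)"
    by (simp add: mat2_eq_iff conj_transpose_nth)
  then show "\<one>\<^bsub>SU2\<^esub> \<in> carrier SU2" by (simp add: SU2_def)
next
  fix A assume A: "A \<in> carrier SU2"
  show "\<exists>B\<in>carrier SU2. B \<otimes>\<^bsub>SU2\<^esub> A = \<one>\<^bsub>SU2\<^esub>"
    using conj_transpose_in_SU2[OF A] A by (intro bexI[of _ "conj_transpose A"]) (auto simp: SU2_def)
qed (simp_all add: matrix_mul_assoc)

interpretation SU2: group SU2
  by (rule group_SU2)

lemma SU2_inv: "U \<in> carrier SU2 \<Longrightarrow> inv\<^bsub>SU2\<^esub> U = conj_transpose U"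
  by (rule SU2.inv_equality) (auto simp: conj_transpose_in_SU2, simp add: SU2_def)

lemma SU2_mult_conj_transpose:
  assumes "U \<in> carrier SU2"
  shows "U ** conj_transpose U = mat 1" "conj_transpose U ** U = mat 1"
  using assms by (simp_all add: SU2_def)

text \<open>
  For a unitary matrix of determinant \<open>1\<close> the adjugate is the conjugate transpose, so such a matrix is
  determined by its first column.
\<close>

lemma SU2_iff:
  "U \<in> carrier SU2 \<longleftrightarrow> U$2$2 = cnj (U$1$1) \<and> U$1$2 = - cnj (U$2$1) \<and>
     U$1$1 * cnj (U$1$1) + U$2$1 * cnj (U$2$1) = 1" (is "?L \<longleftrightarrow> ?R")
proof
  assume ?L
  then have e: "U$1$1 * cnj (U$1$1) + U$1$2 * cnj (U$1$2) = 1"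
      "U$2$1 * cnj (U$1$1) + U$2$2 * cnj (U$1$2) = 0"
      "cnj (U$1$1) * U$1$1 + cnj (U$2$1) * U$2$1 = 1"
      "U$1$1 * U$2$2 - U$1$2 * U$2$1 = 1"
      "cnj (U$1$1) * U$1$2 + cnj (U$2$1) * U$2$2 = 0"
    by (auto simp: SU2_def mat2_eq_iff matmul2_nth conj_transpose_nth det_2)
  have "U$2$2 = cnj (U$1$1)" using e by algebra
  moreover have "U$1$2 = - cnj (U$2$1)" using e by algebra
  ultimately show ?R using e(3) by (simp add: mult.commute)
next
  assume ?R
  then show ?L
    by (auto simp: SU2_def mat2_eq_iff matmul2_nth conj_transpose_nth det_2 algebra_simps)
qed

definition diag_cis :: "real \<Rightarrow> complex^2^2" where
  "diag_cis t = diag2 (cis t) (cis (- t))"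

lemma diag_cis_in_SU2 [simp]: "diag_cis t \<in> carrier SU2"
  by (simp add: SU2_iff diag_cis_def cis_cnj cis_mult)

lemma diag_cis_mult: "diag_cis s ** diag_cis t = diag_cis (s + t)"
  by (simp add: mat2_eq_iff matmul2_nth diag_cis_def cis_mult)

lemma diag_cis_zero [simp]: "diag_cis 0 = mat 1"
  by (simp add: mat2_eq_iff diag_cis_def)

lemma trace_diag_cis [simp]: "trace (diag_cis t) = complex_of_real (2 * cos t)"
  by (simp add: trace_2 diag_cis_def complex_eq_iff)

lemma diag_cis_pow: "diag_cis t [^]\<^bsub>SU2\<^esub> (n::nat) = diag_cis (real n * t)"
  by (induction n) (simp_all add: diag_cis_mult algebra_simps)

lemma diag_cis_int_pow: "diag_cis t [^]\<^bsub>SU2\<^esub> (k::int) = diag_cis (real_of_int k * t)"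
proof (cases k)
  case (nonneg n)
  then show ?thesis by (simp add: int_pow_int diag_cis_pow)
next
  case (neg n)
  have inv: "inv\<^bsub>SU2\<^esub> (diag_cis s) = diag_cis (- s)" for s
    by (rule SU2.inv_equality) (simp_all add: diag_cis_mult)
  then show ?thesis unfolding neg
    by (subst SU2.int_pow_neg_int) (simp_all add: diag_cis_pow diag_cis_mult inv algebra_simps)
qed

text \<open>
  The eigenvalues are \<open>cis \<theta>\<close> and \<open>cis (- \<theta>)\<close> with \<open>2 cos \<theta>\<close> the trace.  The vector
  \<open>(w, \<beta>)\<close> with \<open>w = cis \<theta> - cnj \<alpha>\<close> is an eigenvector for \<open>cis \<theta>\<close>; after normalization it is the
  first column of the conjugating matrix \<open>conj_transpose V\<close>.  It vanishes only if \<open>U\<close> is diagonal with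
  \<open>cis (- \<theta>)\<close> as its first entry, and then the two basis vectors have to be exchanged.
\<close>

lemma SU2_diagonalize:
  assumes U: "U \<in> carrier SU2"
  obtains V \<theta> where "V \<in> carrier SU2" "0 \<le> \<theta>" "\<theta> \<le> pi"
    "V ** U ** conj_transpose V = diag_cis \<theta>"
proof -
  define \<alpha> \<beta> where "\<alpha> = U$1$1" and "\<beta> = U$2$1"
  have ent: "U$1$1 = \<alpha>" "U$2$1 = \<beta>" "U$1$2 = - cnj \<beta>" "U$2$2 = cnj \<alpha>"
    and unit: "\<alpha> * cnj \<alpha> + \<beta> * cnj \<beta> = 1"
    using U by (auto simp: SU2_iff \<alpha>_def \<beta>_def)
  define \<theta> where "\<theta> = arccos (Re \<alpha>)"
  have "(Re \<alpha>)\<^sup>2 + (Im \<alpha>)\<^sup>2 + ((Re \<beta>)\<^sup>2 + (Im \<beta>)\<^sup>2) = 1"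
    using arg_cong[OF unit, of Re] by (simp add: power2_eq_square)
  moreover from this have "(Re \<alpha>)\<^sup>2 \<le> 1" 
    using zero_le_power2[of "Im \<alpha>"] zero_le_power2[of "Re \<beta>"] zero_le_power2[of "Im \<beta>"] by linarith
  ultimately have re: "\<bar>Re \<alpha>\<bar> \<le> 1" by (simp add: abs_square_le_1)
  then have th: "0 \<le> \<theta>" "\<theta> \<le> pi" "cos \<theta> = Re \<alpha>"
    by (auto simp: \<theta>_def arccos_lbound arccos_ubound)
  define l where "l = cis \<theta>"
  have l: "l * cnj l = 1" "l + cnj l = \<alpha> + cnj \<alpha>"
    using th by (simp_all add: l_def cis_cnj cis_mult complex_eq_iff)
  define w where "w = l - cnj \<alpha>"
  define n where "n = w * cnj w + \<beta> * cnj \<beta>"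
  have n: "n = complex_of_real ((cmod w)\<^sup>2 + (cmod \<beta>)\<^sup>2)"
    unfolding n_def of_real_add complex_norm_square ..
  show thesis
  proof (cases "n = 0")
    case True
    then have "(cmod w)\<^sup>2 + (cmod \<beta>)\<^sup>2 = 0" unfolding n of_real_eq_0_iff .
    then have "\<beta> = 0" "w = 0" by (auto simp: add_nonneg_eq_0_iff)
    then have l': "l = cnj \<alpha>" by (simp add: w_def)
    define J :: "complex^2^2" where "J = vector [vector [0, -1], vector [1, 0]]"
    have "J \<in> carrier SU2" by (simp add: J_def SU2_iff)
    moreover have "J ** U ** conj_transpose J = diag_cis \<theta>"
      using l' \<open>\<beta> = 0\<close>
      by (auto simp: mat2_eq_iff matmul2_nth conj_transpose_nth J_def ent diag_cis_def l_def simp flip: cis_cnj)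
    ultimately show thesis using th that by blast
  next
    case False
    define k where "k = sqrt ((cmod w)\<^sup>2 + (cmod \<beta>)\<^sup>2)"
    have kk: "complex_of_real k * of_real k = n"
      unfolding n k_def by (simp flip: of_real_mult)
    then have k0: "complex_of_real k \<noteq> 0" using False by auto
    define V :: "complex^2^2" where
      "V = vector [vector [cnj w / k, cnj \<beta> / k], vector [- \<beta> / k, w / k]]"
    have Vn: "V$1$1 = cnj w / k" "V$1$2 = cnj \<beta> / k" "V$2$1 = - \<beta> / k" "V$2$2 = w / k"
      by (simp_all add: V_def)
    have "cnj w / k * (w / k) + \<beta> / k * (cnj \<beta> / k) = n / (of_real k * of_real k)"
      by (simp add: n_def add_divide_distrib mult.commute)
    then have V: "V \<in> carrier SU2"
      using False unfolding kk by (simp add: SU2_iff Vn)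
    have VU: "V ** U = diag_cis \<theta> ** V"
    proof -
      have "cnj w * \<alpha> + cnj \<beta> * \<beta> = l * cnj w"
        "- (cnj w * cnj \<beta>) + cnj \<beta> * cnj \<alpha> = l * cnj \<beta>"
        "- (\<beta> * \<alpha>) + w * \<beta> = - (cnj l * \<beta>)"
        "\<beta> * cnj \<beta> + w * cnj \<alpha> = cnj l * w"
        using l unit unfolding w_def complex_cnj_diff complex_cnj_cnj by algebra+
      moreover from this(3) have "\<beta> * (w * k) + \<beta> * (k * cnj l) = \<alpha> * (\<beta> * k)"
        by algebra
      ultimately show ?thesis
        using k0 by (simp add: mat2_eq_iff matmul2_nth Vn ent diag_cis_def l_def cis_cnj field_simps)
    qed
    have "V ** U ** conj_transpose V = diag_cis \<theta> ** (V ** conj_transpose V)"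
      by (simp add: VU matrix_mul_assoc)
    then show thesis using V th that by (simp add: SU2_mult_conj_transpose)
  qed
qed

lemma trace_conj_SU2:
  assumes "V \<in> carrier SU2"
  shows "trace (V ** U ** conj_transpose V) = trace U"
proof -
  have "trace (V ** U ** conj_transpose V) = trace (conj_transpose V ** V ** U)"
    by (metis matrix_mul_assoc trace_mul_sym)
  then show ?thesis using assms by (simp add: SU2_mult_conj_transpose)
qed

lemma conj_cancel_SU2:
  assumes "V \<in> carrier SU2"
  shows "conj_transpose V ** (V ** U ** conj_transpose V) ** V = U"
proof -
  have "conj_transpose V ** (V ** U ** conj_transpose V) ** V = (conj_transpose V ** V) ** U ** (conj_transpose V ** V)"
    by (simp only: matrix_mul_assoc)
  then show ?thesis using assms by (simp add: SU2_mult_conj_transpose)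
qed

text \<open>
  The two eigenvalues are conjugate and of modulus \<open>1\<close>, so their sum is \<open>\<plusminus>2\<close> only if both are \<open>\<plusminus>1\<close>.
  Hence \<open>\<rho>(g) = \<plusminus>1\<close> can be read off from the trace, which is continuous on the classes.
\<close>

lemma SU2_eq_scalarI:
  assumes "U \<in> carrier SU2" and "trace U = complex_of_real (2 * e)" "e = 1 \<or> e = -1"
  shows "U = mat (complex_of_real e)"
proof -
  obtain V \<theta> where V: "V \<in> carrier SU2" "0 \<le> \<theta>" "\<theta> \<le> pi" "V ** U ** conj_transpose V = diag_cis \<theta>"
    by (rule SU2_diagonalize[OF assms(1)])
  have "complex_of_real (2 * cos \<theta>) = complex_of_real (2 * e)"
    using trace_conj_SU2[OF V(1), of U] assms(2) V(4) by simp
  then have c: "cos \<theta> = e" by (simp only: of_real_eq_iff)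
  then have "sin \<theta> = 0" using assms(3) sin_cos_squared_add[of \<theta>] by auto
  then have "diag_cis \<theta> = mat (complex_of_real e)"
    using c by (simp add: mat2_eq_iff diag_cis_def complex_eq_iff)
  moreover have "conj_transpose V ** mat (complex_of_real e) ** V
      = mat (complex_of_real e) ** (conj_transpose V ** V)"
    by (simp add: mat2_eq_iff matmul2_nth algebra_simps)
  ultimately show ?thesis
    using conj_cancel_SU2[OF V(1), of U] V by (simp add: SU2_mult_conj_transpose)
qed

section \<open>Roots of a common power in a group\<close>

lemma (in group) commutes_int_pow:
  assumes "x \<otimes> y = y \<otimes> x" "x \<in> carrier G" "y \<in> carrier G"
  shows "x [^] (i::int) \<otimes> y = y \<otimes> x [^] i"
proof -
  have nat: "x [^] n \<otimes> y = y \<otimes> x [^] n" for n :: nat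
    using assms by (rule group_commutes_pow)
  have "inv (x [^] n) \<otimes> y = y \<otimes> inv (x [^] n)" for n :: nat
  proof -
    have a: "x [^] n \<in> carrier G" using assms by simp
    have "inv (x [^] n) \<otimes> y = inv (x [^] n) \<otimes> (y \<otimes> x [^] n \<otimes> inv (x [^] n))"
      using a assms by (simp add: m_assoc)
    also have "\<dots> = inv (x [^] n) \<otimes> (x [^] n \<otimes> y \<otimes> inv (x [^] n))" by (simp only: nat)
    also have "\<dots> = y \<otimes> inv (x [^] n)" using a assms by (simp add: m_assoc [symmetric])
    finally show ?thesis .
  qed
  then show ?thesis by (cases i rule: int_cases2) (simp_all add: int_pow_int int_pow_neg_int assms nat)
qed

text \<open>
  This is the reason why the torus knot group has an infinite cyclic abelianization generated by a
  meridian.  If \<open>x\<close> and \<open>y\<close> commute, \<open>t = x\<^sup>s y\<^sup>r\<close> satisfies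
  \<open>t\<^sup>n = x\<^sup>s\<^sup>n y\<^sup>n\<^sup>r = x\<^sup>s\<^sup>n x\<^sup>m\<^sup>r = x\<^sup>e\<close>, and raising to the power \<open>e = \<plusminus>1\<close> recovers \<open>x\<close>;
  symmetrically for \<open>y\<close>.
\<close>

lemma commuting_roots:
  fixes G (structure) and s r e :: int and m n :: nat
  assumes "group G" and x: "x \<in> carrier G" "y \<in> carrier G" "x \<otimes> y = y \<otimes> x"
    and rel: "x [^] m = y [^] n"
    and bezout: "s * int n + r * int m = e" "e * e = 1"
  shows "x = (x [^] s \<otimes> y [^] r) [^] (e * int n)"
    and "y = (x [^] s \<otimes> y [^] r) [^] (e * int m)"
proof -
  interpret group G by fact
  have rel': "x [^] int m = y [^] int n" using rel by (simp add: int_pow_int)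
  have comm: "x [^] i \<otimes> y [^] j = y [^] j \<otimes> x [^] i" for i j :: int
  proof -
    have "y \<otimes> x [^] i = x [^] i \<otimes> y" using commutes_int_pow[of x y i] x by simp
    then show ?thesis using commutes_int_pow[of y "x [^] i" j] x by simp
  qed
  have pw: "(x [^] s \<otimes> y [^] r) [^] k = x [^] (s * k) \<otimes> y [^] (r * k)" for k :: int
    using int_pow_mult_distrib[OF comm[of s r], of k] x by (simp add: int_pow_pow)
  have "y [^] (r * int n) = x [^] (int m * r)" "x [^] (s * int m) = y [^] (int n * s)"
    using rel' x(1,2) by (metis int_pow_pow mult.commute)+
  then have "(x [^] s \<otimes> y [^] r) [^] int n = x [^] (s * int n + r * int m)"
    "(x [^] s \<otimes> y [^] r) [^] int m = y [^] (s * int n + r * int m)"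
    using x unfolding pw by (simp_all add: int_pow_mult mult.commute)
  then have "(x [^] s \<otimes> y [^] r) [^] int n = x [^] e" "(x [^] s \<otimes> y [^] r) [^] int m = y [^] e"
    unfolding bezout(1) .
  moreover have "(x [^] e) [^] e = x" "(y [^] e) [^] e = y"
    using x bezout(2) by (simp_all add: int_pow_pow)
  ultimately have "((x [^] s \<otimes> y [^] r) [^] int n) [^] e = x" "((x [^] s \<otimes> y [^] r) [^] int m) [^] e = y"
    by simp_all
  then show "x = (x [^] s \<otimes> y [^] r) [^] (e * int n)" "y = (x [^] s \<otimes> y [^] r) [^] (e * int m)"
    using x by (simp_all add: int_pow_pow mult.commute)
qed

section \<open>Representations of the torus knot group\<close>

lemma carrier_torus_group: "carrier (torus_group p q) = range (word_class (torus_rel p q))"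
  by (simp add: torus_group_def presented_group_def)

lemma torus_group_mult:
  "word_class (torus_rel p q) u \<otimes>\<^bsub>torus_group p q\<^esub> word_class (torus_rel p q) v
     = word_class (torus_rel p q) (u @ v)"
  by (simp add: torus_group_def presented_group_mult)

lemma torus_group_one: "\<one>\<^bsub>torus_group p q\<^esub> = word_class (torus_rel p q) []"
  by (simp add: torus_group_def presented_group_def)

lemma torus_gens_in_carrier [simp]:
  "torus_x p q \<in> carrier (torus_group p q)" "torus_y p q \<in> carrier (torus_group p q)"
  by (simp_all add: torus_x_def torus_y_def carrier_torus_group)

lemma torus_zeta_in_carrier [simp]: "torus_zeta p q \<in> carrier (torus_group p q)"
  by (simp add: torus_zeta_def group.is_monoid[OF group_torus_group] monoid.nat_pow_closed)

lemma torus_rep_group_hom: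
  "\<rho> \<in> torus_reps p q \<Longrightarrow> group_hom (torus_group p q) SU2 \<rho>"
  by (simp add: torus_reps_def group_hom_def group_hom_axioms_def group_torus_group group_SU2)

lemma torus_rep_in_SU2:
  "\<rho> \<in> torus_reps p q \<Longrightarrow> g \<in> carrier (torus_group p q) \<Longrightarrow> \<rho> g \<in> carrier SU2"
  by (auto simp: torus_reps_def hom_def)

lemma torus_rep_mult:
  "\<rho> \<in> torus_reps p q \<Longrightarrow> g \<in> carrier (torus_group p q) \<Longrightarrow> h \<in> carrier (torus_group p q) \<Longrightarrow>
     \<rho> (g \<otimes>\<^bsub>torus_group p q\<^esub> h) = \<rho> g ** \<rho> h"
  by (auto simp: torus_reps_def hom_def)

lemma torus_rep_inv:
  "\<rho> \<in> torus_reps p q \<Longrightarrow> g \<in> carrier (torus_group p q) \<Longrightarrow>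
     \<rho> (inv\<^bsub>torus_group p q\<^esub> g) = conj_transpose (\<rho> g)"
  using group_hom.hom_inv[OF torus_rep_group_hom] by (simp add: SU2_inv torus_rep_in_SU2)

lemma torus_rep_zeta:
  assumes "\<rho> \<in> torus_reps p q"
  shows "\<rho> (torus_zeta p q) = \<rho> (torus_x p q) [^]\<^bsub>SU2\<^esub> p"
  unfolding torus_zeta_def
  by (rule group_hom.hom_nat_pow[OF torus_rep_group_hom[OF assms]]) simp

lemma torus_rep_eqI:
  assumes reps: "\<rho> \<in> torus_reps p q" "\<sigma> \<in> torus_reps p q"
    and eq: "\<rho> (torus_x p q) = \<sigma> (torus_x p q)" "\<rho> (torus_y p q) = \<sigma> (torus_y p q)"
  shows "\<rho> = \<sigma>"
proof (rule extensionalityI)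
  show "\<rho> \<in> extensional (carrier (torus_group p q))" "\<sigma> \<in> extensional (carrier (torus_group p q))"
    using reps by (simp_all add: torus_reps_def)
  interpret G: group "torus_group p q" by (rule group_torus_group)
  let ?c = "word_class (torus_rel p q)"
  have c: "?c w \<in> carrier (torus_group p q)" for w by (simp add: carrier_torus_group)
  have letter: "\<rho> (?c [(g, True)]) = \<sigma> (?c [(g, True)])" for g
    using eq by (cases g) (simp_all add: torus_x_def torus_y_def)
  have "word_eq (torus_rel p q) [(g, False), (g, True)] []" for g
    using word_cancel[of "torus_rel p q" "[]" g False "[]"] by simp
  then have "?c [(g, False)] \<otimes>\<^bsub>torus_group p q\<^esub> ?c [(g, True)] = \<one>\<^bsub>torus_group p q\<^esub>" for g
    by (simp add: torus_group_mult torus_group_one word_class_eq_iff)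
  then have "?c [(g, False)] = inv\<^bsub>torus_group p q\<^esub> ?c [(g, True)]" for g
    using G.inv_equality[OF _ c c] by metis
  then have letter': "\<rho> (?c [(g, s)]) = \<sigma> (?c [(g, s)])" for g s
    using reps letter by (cases s) (simp_all add: torus_rep_inv c)
  have "\<rho> (?c w) = \<sigma> (?c w)" for w
  proof (induction w)
    case Nil
    then show ?case
      using reps group_hom.hom_one[OF torus_rep_group_hom] unfolding torus_group_one by metis
  next
    case (Cons a w)
    have "?c (a # w) = ?c [a] \<otimes>\<^bsub>torus_group p q\<^esub> ?c w" by (simp add: torus_group_mult)
    then show ?case using reps Cons letter' by (cases a) (simp add: torus_rep_mult c)
  qed
  then show "\<rho> g = \<sigma> g" if "g \<in> carrier (torus_group p q)" for g
    using that by (auto simp: carrier_torus_group)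
qed

text \<open>
  On words, this is the homomorphism \<open>\<Gamma> \<rightarrow> \<int>\<close> that sends \<open>x\<close> to \<open>q\<close> and \<open>y\<close> to \<open>p\<close>; for coprime
  \<open>p\<close> and \<open>q\<close> it is the abelianization.  It yields abelian
  representations with a prescribed eigenvalue at the meridian.
\<close>

definition word_degree :: "nat \<Rightarrow> nat \<Rightarrow> torus_gen word \<Rightarrow> int" where
  "word_degree p q w =
     (\<Sum>(g, s)\<leftarrow>w. (if s then 1 else - 1) * (case g of Gx \<Rightarrow> int q | Gy \<Rightarrow> int p))"

lemma word_degree_append [simp]: "word_degree p q (u @ v) = word_degree p q u + word_degree p q v"
  by (simp add: word_degree_def)

lemma word_degree_cong: "word_eq (torus_rel p q) u v \<Longrightarrow> word_degree p q u = word_degree p q v"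
proof (induction rule: word_eq.induct)
  case (word_cancel u g s v)
  then show ?case by (simp add: word_degree_def)
next
  case (word_relation l r u v)
  then have "word_degree p q l = word_degree p q r"
    by (simp add: torus_rel_def word_degree_def sum_list_replicate)
  then show ?case by simp
qed simp_all

definition torus_degree :: "nat \<Rightarrow> nat \<Rightarrow> torus_gen word set \<Rightarrow> int" where
  "torus_degree p q g = word_degree p q (SOME w. w \<in> g)"

lemma torus_degree_word_class [simp]:
  "torus_degree p q (word_class (torus_rel p q) w) = word_degree p q w"
proof -
  have "w \<in> word_class (torus_rel p q) w" by (simp add: word_class_def word_refl)
  then have "(SOME w'. w' \<in> word_class (torus_rel p q) w) \<in> word_class (torus_rel p q) w"
    by (rule someI)
  then have "word_degree p q w = word_degree p q (SOME w'. w' \<in> word_class (torus_rel p q) w)"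
    by (intro word_degree_cong) (simp add: word_class_def)
  then show ?thesis by (simp add: torus_degree_def)
qed

definition diag_rep :: "nat \<Rightarrow> nat \<Rightarrow> real \<Rightarrow> torus_rep" where
  "diag_rep p q t = (\<lambda>g\<in>carrier (torus_group p q). diag_cis (real_of_int (torus_degree p q g) * t))"

lemma diag_rep_in_reps: "diag_rep p q t \<in> torus_reps p q"
proof -
  interpret G: group "torus_group p q" by (rule group_torus_group)
  have "diag_rep p q t (g \<otimes>\<^bsub>torus_group p q\<^esub> h) = diag_rep p q t g ** diag_rep p q t h"
    if gh: "g \<in> carrier (torus_group p q)" "h \<in> carrier (torus_group p q)" for g h
  proof -
    have "torus_degree p q (g \<otimes>\<^bsub>torus_group p q\<^esub> h) = torus_degree p q g + torus_degree p q h"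
      using gh by (auto simp: carrier_torus_group torus_group_mult)
    then show ?thesis using gh by (simp add: diag_rep_def diag_cis_mult distrib_right)
  qed
  moreover have "diag_rep p q t g \<in> carrier SU2" if "g \<in> carrier (torus_group p q)" for g
    using that by (simp add: diag_rep_def)
  ultimately show ?thesis
    by (simp add: torus_reps_def hom_def diag_rep_def)
qed

lemma diag_rep_abelian: "abelian_image p q (diag_rep p q t)"
  by (simp add: abelian_image_def diag_rep_def diag_cis_mult add.commute)

lemma diag_rep_gens:
  "diag_rep p q t (torus_x p q) = diag_cis (real q * t)"
  "diag_rep p q t (torus_y p q) = diag_cis (real p * t)"
  by (simp_all add: diag_rep_def) (simp_all add: torus_x_def torus_y_def word_degree_def)

text \<open>
  A representation with abelian image does not see the conjugation in the definition of a meridian.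
  The exponents \<open>s\<close> and \<open>r\<close> do not depend on the representation.
\<close>

lemma torus_meridian_abelian:
  assumes "torus_meridian p q \<mu>"
  obtains s r :: int where
    "(s * int q + r * int p) * (s * int q + r * int p) = 1"
    "\<mu> \<in> carrier (torus_group p q)"
    "\<And>\<rho>. \<rho> \<in> torus_reps p q \<Longrightarrow> abelian_image p q \<rho> \<Longrightarrow>
       \<rho> \<mu> = \<rho> (torus_x p q) [^]\<^bsub>SU2\<^esub> s ** \<rho> (torus_y p q) [^]\<^bsub>SU2\<^esub> r"
proof -
  interpret G: group "torus_group p q" by (rule group_torus_group)
  let ?x = "torus_x p q" and ?y = "torus_y p q"
  obtain g s r where g: "g \<in> carrier (torus_group p q)" and sr: "\<bar>s * int q + r * int p\<bar> = 1"
    and \<mu>: "\<mu> = g \<otimes>\<^bsub>torus_group p q\<^esub>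
            (?x [^]\<^bsub>torus_group p q\<^esub> s \<otimes>\<^bsub>torus_group p q\<^esub> ?y [^]\<^bsub>torus_group p q\<^esub> r)
            \<otimes>\<^bsub>torus_group p q\<^esub> inv\<^bsub>torus_group p q\<^esub> g"
    using assms unfolding torus_meridian_def by blast
  define m where "m = ?x [^]\<^bsub>torus_group p q\<^esub> s \<otimes>\<^bsub>torus_group p q\<^esub> ?y [^]\<^bsub>torus_group p q\<^esub> r"
  have m: "m \<in> carrier (torus_group p q)" by (simp add: m_def)
  have "(s * int q + r * int p) * (s * int q + r * int p) = 1"
    using sr by (metis abs_mult_self_eq mult_1)
  moreover have "\<mu> \<in> carrier (torus_group p q)" using g by (simp add: \<mu>)
  moreover have "\<rho> \<mu> = \<rho> ?x [^]\<^bsub>SU2\<^esub> s ** \<rho> ?y [^]\<^bsub>SU2\<^esub> r"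
    if \<rho>: "\<rho> \<in> torus_reps p q" and ab: "abelian_image p q \<rho>" for \<rho>
  proof -
    have "\<rho> \<mu> = \<rho> g ** \<rho> m ** conj_transpose (\<rho> g)"
      using g m unfolding \<mu> m_def [symmetric] by (simp add: torus_rep_mult[OF \<rho>] torus_rep_inv[OF \<rho>])
    also have "\<dots> = \<rho> m ** (\<rho> g ** conj_transpose (\<rho> g))"
      using ab g m unfolding abelian_image_def by (metis matrix_mul_assoc)
    also have "\<dots> = \<rho> m" using torus_rep_in_SU2[OF \<rho> g] by (simp add: SU2_mult_conj_transpose)
    finally show ?thesis
      by (simp add: m_def torus_rep_mult[OF \<rho>] group_hom.hom_int_pow[OF torus_rep_group_hom[OF \<rho>]])
  qed
  ultimately show thesis by (rule that)
qed

lemma abelian_rep_gens: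
  assumes \<rho>: "\<rho> \<in> torus_reps p q" "abelian_image p q \<rho>"
    and e: "e = s * int q + r * int p" "e * e = 1"
    and \<mu>: "\<rho> \<mu> = \<rho> (torus_x p q) [^]\<^bsub>SU2\<^esub> s ** \<rho> (torus_y p q) [^]\<^bsub>SU2\<^esub> r"
  shows "\<rho> (torus_x p q) = \<rho> \<mu> [^]\<^bsub>SU2\<^esub> (e * int q)" "\<rho> (torus_y p q) = \<rho> \<mu> [^]\<^bsub>SU2\<^esub> (e * int p)"
proof -
  have "\<rho> (torus_x p q) [^]\<^bsub>SU2\<^esub> p = \<rho> (torus_y p q) [^]\<^bsub>SU2\<^esub> q"
    using torus_rep_zeta[OF \<rho>(1)] group_hom.hom_nat_pow[OF torus_rep_group_hom[OF \<rho>(1)], of "torus_y p q" q]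
    by (simp add: torus_zeta_eq)
  then show "\<rho> (torus_x p q) = \<rho> \<mu> [^]\<^bsub>SU2\<^esub> (e * int q)" "\<rho> (torus_y p q) = \<rho> \<mu> [^]\<^bsub>SU2\<^esub> (e * int p)"
    using commuting_roots[OF group_SU2, of "\<rho> (torus_x p q)" "\<rho> (torus_y p q)" p q s r e] \<rho> e
    unfolding \<mu> by (simp_all add: torus_rep_in_SU2 abelian_image_def)
qed

lemma rep_conj_in_reps:
  assumes \<rho>: "\<rho> \<in> torus_reps p q" and V: "V \<in> carrier SU2"
  shows "rep_conj p q V \<rho> \<in> torus_reps p q"
proof -
  interpret G: group "torus_group p q" by (rule group_torus_group)
  have "V ** A ** conj_transpose V \<in> carrier SU2" if "A \<in> carrier SU2" for A
    using SU2.m_closed[OF SU2.m_closed[OF V that] conj_transpose_in_SU2[OF V]] by simp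
  moreover have "V ** (A ** B) ** conj_transpose V
      = V ** A ** conj_transpose V ** (V ** B ** conj_transpose V)" for A B
  proof -
    have "V ** A ** conj_transpose V ** (V ** B ** conj_transpose V)
        = V ** A ** (conj_transpose V ** V) ** B ** conj_transpose V"
      by (simp only: matrix_mul_assoc)
    then show ?thesis using V by (simp add: SU2_mult_conj_transpose matrix_mul_assoc)
  qed
  ultimately show ?thesis
    using \<rho> by (auto simp: torus_reps_def hom_def rep_conj_def)
qed

lemma rep_conj_rep_conj:
  "rep_conj p q U (rep_conj p q V \<rho>) = rep_conj p q (U ** V) \<rho>"
  by (rule ext) (simp add: rep_conj_def conj_transpose_mult matrix_mul_assoc)

lemma rep_class_rep_conj:
  assumes V: "V \<in> carrier SU2"
  shows "rep_class p q (rep_conj p q V \<rho>) = rep_class p q \<rho>"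
proof
  show "rep_class p q (rep_conj p q V \<rho>) \<subseteq> rep_class p q \<rho>"
    using SU2.m_closed[OF _ V] by (auto simp: rep_class_def rep_conj_rep_conj)
  have "rep_conj p q U \<rho> = rep_conj p q (U ** conj_transpose V) (rep_conj p q V \<rho>)" for U
  proof -
    have "U ** conj_transpose V ** V = U ** (conj_transpose V ** V)" by (simp only: matrix_mul_assoc)
    then show ?thesis using V by (simp add: rep_conj_rep_conj SU2_mult_conj_transpose)
  qed
  moreover have "U ** conj_transpose V \<in> carrier SU2" if "U \<in> carrier SU2" for U
    using SU2.m_closed[OF that conj_transpose_in_SU2[OF V]] by simp
  ultimately show "rep_class p q \<rho> \<subseteq> rep_class p q (rep_conj p q V \<rho>)"
    unfolding rep_class_def by blast
qed

lemma rep_class_memD: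
  assumes "\<sigma> \<in> rep_class p q \<rho>" "\<rho> \<in> torus_reps p q"
  shows "\<sigma> \<in> torus_reps p q" "rep_class p q \<sigma> = rep_class p q \<rho>"
    "g \<in> carrier (torus_group p q) \<Longrightarrow> trace (\<sigma> g) = trace (\<rho> g)"
proof -
  obtain V where V: "V \<in> carrier SU2" "\<sigma> = rep_conj p q V \<rho>"
    using assms(1) unfolding rep_class_def by blast
  show "\<sigma> \<in> torus_reps p q" "rep_class p q \<sigma> = rep_class p q \<rho>"
    using assms V by (simp_all add: rep_conj_in_reps rep_class_rep_conj)
  show "trace (\<sigma> g) = trace (\<rho> g)" if "g \<in> carrier (torus_group p q)"
    using that V by (simp add: rep_conj_def trace_conj_SU2)
qed

lemma rep_class_self: "\<rho> \<in> torus_reps p q \<Longrightarrow> \<rho> \<in> rep_class p q \<rho>"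
proof -
  assume "\<rho> \<in> torus_reps p q"
  then have "\<rho> = rep_conj p q (mat 1) \<rho>"
    unfolding torus_reps_def rep_conj_def
    by (intro extensionalityI[of _ "carrier (torus_group p q)"])
       (auto simp: mat2_eq_iff matmul2_nth conj_transpose_nth)
  moreover have "mat 1 \<in> carrier SU2" using SU2.one_closed by simp
  ultimately show ?thesis unfolding rep_class_def by blast
qed

lemma rep_class_diagonal_at:
  assumes "\<rho> \<in> torus_reps p q" "g \<in> carrier (torus_group p q)"
  obtains \<sigma> \<theta> where "\<sigma> \<in> rep_class p q \<rho>" "0 \<le> \<theta>" "\<theta> \<le> pi" "\<sigma> g = diag_cis \<theta>"
proof -
  obtain V \<theta> where "V \<in> carrier SU2" "0 \<le> \<theta>" "\<theta> \<le> pi" "V ** \<rho> g ** conj_transpose V = diag_cis \<theta>"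
    by (rule SU2_diagonalize[OF torus_rep_in_SU2[OF assms]])
  then show thesis using assms by (intro that[of "rep_conj p q V \<rho>" \<theta>]) (auto simp: rep_class_def rep_conj_def)
qed

text \<open>
  The condition \<open>v \<ge> 0\<close> selects the argument in \<open>[0, \<pi>]\<close>, which is determined by the trace.
\<close>

lemma normalized_reps_iff:
  "\<rho> \<in> normalized_reps p q \<mu> \<longleftrightarrow> \<rho> \<in> torus_reps p q \<and> (\<exists>\<theta>\<in>{0..pi}. \<rho> \<mu> = diag_cis \<theta>)"
proof -
  have "(\<exists>u v. u\<^sup>2 + v\<^sup>2 = 1 \<and> 0 \<le> v \<and> M = diag2 (Complex u v) (Complex u (- v)))
      \<longleftrightarrow> (\<exists>\<theta>\<in>{0..pi}. M = diag_cis \<theta>)" for M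
  proof
    assume "\<exists>u v. u\<^sup>2 + v\<^sup>2 = 1 \<and> 0 \<le> v \<and> M = diag2 (Complex u v) (Complex u (- v))"
    then obtain u v where uv: "u\<^sup>2 + v\<^sup>2 = 1" "0 \<le> v" and M: "M = diag2 (Complex u v) (Complex u (- v))"
      by blast
    obtain \<theta> where "0 \<le> \<theta>" "\<theta> \<le> pi" "u = cos \<theta>" "v = sin \<theta>"
      using sincos_total_pi[OF uv(2,1)] by blast
    then show "\<exists>\<theta>\<in>{0..pi}. M = diag_cis \<theta>"
      by (intro bexI[of _ \<theta>]) (auto simp: M diag_cis_def complex_eq_iff mat2_eq_iff)
  next
    assume "\<exists>\<theta>\<in>{0..pi}. M = diag_cis \<theta>"
    then obtain \<theta> where "\<theta> \<in> {0..pi}" "M = diag_cis \<theta>" by blast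
    then show "\<exists>u v. u\<^sup>2 + v\<^sup>2 = 1 \<and> 0 \<le> v \<and> M = diag2 (Complex u v) (Complex u (- v))"
      by (intro exI[of _ "cos \<theta>"] exI[of _ "sin \<theta>"])
         (auto simp: diag_cis_def complex_eq_iff mat2_eq_iff sin_ge_zero)
  qed
  then show ?thesis by (simp add: normalized_reps_def)
qed

section \<open>Traces and angles on the character variety\<close>

lemma topspace_torus_reps_topology: "topspace (torus_reps_topology p q) = torus_reps p q"
  by (auto simp: torus_reps_topology_def torus_reps_def PiE_def Pi_def extensional_def)

lemma topspace_charvar: "topspace (charvar p q) = rep_class p q ` torus_reps p q"
  by (simp add: charvar_def topspace_quotient_topology topspace_torus_reps_topology)

text \<open>
  The choice of the representative does not matter, since conjugate matrices have the same trace.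
\<close>

definition class_trace :: "torus_gen word set \<Rightarrow> torus_rep set \<Rightarrow> complex" where
  "class_trace g \<xi> = trace ((SOME \<rho>. \<rho> \<in> \<xi>) g)"

lemma class_trace_rep_class:
  assumes "\<rho> \<in> torus_reps p q" "g \<in> carrier (torus_group p q)"
  shows "class_trace g (rep_class p q \<rho>) = trace (\<rho> g)"
  unfolding class_trace_def
  by (rule rep_class_memD(3)[OF someI[where P = "\<lambda>\<sigma>. \<sigma> \<in> rep_class p q \<rho>"] assms],
      rule rep_class_self[OF assms(1)])

lemma continuous_map_class_trace:
  assumes "g \<in> carrier (torus_group p q)"
  shows "continuous_map (charvar p q) euclidean (class_trace g)"
proof -
  have "continuous_map euclidean euclidean (trace :: complex^2^2 \<Rightarrow> complex)"
    unfolding continuous_map_iff_continuous2 trace_2 by (intro continuous_intros)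
  moreover have "continuous_map (product_topology (\<lambda>_. euclidean) (carrier (torus_group p q))) euclidean
      (\<lambda>\<rho>. \<rho> g :: complex^2^2)"
    using continuous_map_product_projection[OF assms, of "\<lambda>_. euclidean"] by simp
  ultimately have "continuous_map (torus_reps_topology p q) euclidean (trace \<circ> (\<lambda>\<rho>. \<rho> g))"
    unfolding torus_reps_topology_def
    by (intro continuous_map_from_subtopology) (rule continuous_map_compose)
  then have "continuous_map (torus_reps_topology p q) euclidean (class_trace g \<circ> rep_class p q)"
    by (rule continuous_map_eq) (simp add: topspace_torus_reps_topology class_trace_rep_class assms)
  then show ?thesis
    unfolding charvar_def
    by (simp add: continuous_compose_quotient_map_eq[OF quotient_map_quotient_topology])
qed

text \<open>
  The argument \<open>\<theta> \<in> [0, \<pi>]\<close> for which \<open>\<rho>(\<mu>)\<close> has the eigenvalues \<open>cis \<theta>\<close> and \<open>cis (- \<theta>)\<close>.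
\<close>

definition class_angle :: "torus_gen word set \<Rightarrow> torus_rep set \<Rightarrow> real" where
  "class_angle \<mu> \<xi> = arccos (Re (class_trace \<mu> \<xi>) / 2)"

lemma class_angle_eqI:
  assumes "\<rho> \<in> torus_reps p q" "\<mu> \<in> carrier (torus_group p q)" "\<rho> \<mu> = diag_cis \<theta>" "0 \<le> \<theta>" "\<theta> \<le> pi"
  shows "class_angle \<mu> (rep_class p q \<rho>) = \<theta>"
  using assms by (simp add: class_angle_def class_trace_rep_class arccos_cos)

lemma class_normalized:
  assumes "\<xi> \<in> topspace (charvar p q)" "\<mu> \<in> carrier (torus_group p q)"
  obtains \<rho> where "\<rho> \<in> torus_reps p q" "\<xi> = rep_class p q \<rho>" "\<rho> \<mu> = diag_cis (class_angle \<mu> \<xi>)"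
    "0 \<le> class_angle \<mu> \<xi>" "class_angle \<mu> \<xi> \<le> pi"
proof -
  obtain \<rho>0 where \<rho>0: "\<rho>0 \<in> torus_reps p q" "\<xi> = rep_class p q \<rho>0"
    using assms(1) by (auto simp: topspace_charvar)
  obtain \<rho> \<theta> where \<rho>: "\<rho> \<in> rep_class p q \<rho>0" "0 \<le> \<theta>" "\<theta> \<le> pi" "\<rho> \<mu> = diag_cis \<theta>"
    by (rule rep_class_diagonal_at[OF \<rho>0(1) assms(2)])
  have "\<rho> \<in> torus_reps p q" "\<xi> = rep_class p q \<rho>"
    using rep_class_memD(1,2)[OF \<rho>(1) \<rho>0(1)] \<rho>0(2) by simp_all
  moreover from this have "class_angle \<mu> \<xi> = \<theta>" using class_angle_eqI assms(2) \<rho>(2-4) by simp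
  ultimately show thesis using \<rho> that by simp
qed

lemma continuous_map_class_angle:
  assumes "\<mu> \<in> carrier (torus_group p q)"
  shows "continuous_map (charvar p q) euclidean (class_angle \<mu>)"
proof -
  have "class_trace \<mu> \<xi> \<in> {z. \<bar>Re z\<bar> \<le> 2}" if \<xi>: "\<xi> \<in> topspace (charvar p q)" for \<xi>
  proof -
    obtain \<rho> where \<rho>: "\<rho> \<in> torus_reps p q" "\<xi> = rep_class p q \<rho>" "\<rho> \<mu> = diag_cis (class_angle \<mu> \<xi>)"
      by (rule class_normalized[OF \<xi> assms])
    then have "class_trace \<mu> \<xi> = complex_of_real (2 * cos (class_angle \<mu> \<xi>))"
      using class_trace_rep_class[OF \<rho>(1) assms] by simp
    then show ?thesis using abs_cos_le_one[of "class_angle \<mu> \<xi>"] by (simp add: abs_mult)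
  qed
  then have "continuous_map (charvar p q) (top_of_set {z. \<bar>Re z\<bar> \<le> 2}) (class_trace \<mu>)"
    using continuous_map_class_trace[OF assms] by (auto simp: continuous_map_in_subtopology)
  moreover have "continuous_map (top_of_set {z. \<bar>Re z\<bar> \<le> 2}) euclidean (\<lambda>z. arccos (Re z / 2))"
    unfolding continuous_map_iff_continuous
    by (intro continuous_intros) auto
  ultimately have "continuous_map (charvar p q) euclidean ((\<lambda>z. arccos (Re z / 2)) \<circ> class_trace \<mu>)"
    by (rule continuous_map_compose)
  then show ?thesis by (simp add: comp_def class_angle_def[abs_def])
qed

text \<open>
  A commutator in \<open>SU(2)\<close> is trivial as soon as its trace is \<open>2\<close>.  In this form it is visible that
  being abelian depends only on the class and is a closed condition.
\<close>

lemma abelian_image_iff_trace: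
  assumes \<rho>: "\<rho> \<in> torus_reps p q"
  shows "abelian_image p q \<rho> \<longleftrightarrow>
    (\<forall>g\<in>carrier (torus_group p q). \<forall>h\<in>carrier (torus_group p q).
       trace (\<rho> (g \<otimes>\<^bsub>torus_group p q\<^esub> h \<otimes>\<^bsub>torus_group p q\<^esub>
         inv\<^bsub>torus_group p q\<^esub> g \<otimes>\<^bsub>torus_group p q\<^esub> inv\<^bsub>torus_group p q\<^esub> h)) = 2)"
proof -
  interpret G: group "torus_group p q" by (rule group_torus_group)
  have "\<rho> g ** \<rho> h = \<rho> h ** \<rho> g \<longleftrightarrow>
      trace (\<rho> (g \<otimes>\<^bsub>torus_group p q\<^esub> h \<otimes>\<^bsub>torus_group p q\<^esub>
         inv\<^bsub>torus_group p q\<^esub> g \<otimes>\<^bsub>torus_group p q\<^esub> inv\<^bsub>torus_group p q\<^esub> h)) = 2"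
    if gh: "g \<in> carrier (torus_group p q)" "h \<in> carrier (torus_group p q)" for g h
  proof -
    let ?U = "\<rho> g" and ?V = "\<rho> h"
    let ?W = "?U ** ?V ** conj_transpose ?U ** conj_transpose ?V"
    have UV: "?U \<in> carrier SU2" "?V \<in> carrier SU2" using gh \<rho> by (simp_all add: torus_rep_in_SU2)
    have W: "\<rho> (g \<otimes>\<^bsub>torus_group p q\<^esub> h \<otimes>\<^bsub>torus_group p q\<^esub>
         inv\<^bsub>torus_group p q\<^esub> g \<otimes>\<^bsub>torus_group p q\<^esub> inv\<^bsub>torus_group p q\<^esub> h) = ?W"
      using gh \<rho> by (simp add: torus_rep_mult torus_rep_inv)
    have "?W ** (?V ** ?U) = ?U ** ?V ** conj_transpose ?U ** (conj_transpose ?V ** ?V) ** ?U"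
      by (simp only: matrix_mul_assoc)
    also have "\<dots> = ?U ** ?V ** (conj_transpose ?U ** ?U)"
      by (simp only: SU2_mult_conj_transpose(2)[OF UV(2)] matrix_mul_rid matrix_mul_assoc)
    also have "\<dots> = ?U ** ?V" using UV by (simp add: SU2_mult_conj_transpose)
    finally have eq: "?W ** (?V ** ?U) = ?U ** ?V" .
    have WS: "?W \<in> carrier SU2"
      using UV SU2.m_closed conj_transpose_in_SU2 by (metis SU2_simps(1))
    show ?thesis unfolding W
    proof
      assume "?U ** ?V = ?V ** ?U"
      then have "?W = ?V ** (?U ** conj_transpose ?U) ** conj_transpose ?V"
        by (simp add: matrix_mul_assoc)
      then have "?W = mat 1" using UV by (simp add: SU2_mult_conj_transpose)
      then show "trace ?W = 2" by (simp add: trace_2)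
    next
      assume "trace ?W = 2"
      then have "?W = mat 1" using SU2_eq_scalarI[OF WS, of 1] by simp
      then show "?U ** ?V = ?V ** ?U" using eq by simp
    qed
  qed
  then show ?thesis unfolding abelian_image_def by simp
qed

lemma abelian_image_rep_class:
  assumes "\<sigma> \<in> rep_class p q \<rho>" "\<rho> \<in> torus_reps p q"
  shows "abelian_image p q \<sigma> \<longleftrightarrow> abelian_image p q \<rho>"
proof -
  interpret G: group "torus_group p q" by (rule group_torus_group)
  show ?thesis
    unfolding abelian_image_iff_trace[OF assms(2)] abelian_image_iff_trace[OF rep_class_memD(1)[OF assms]]
    by (simp add: rep_class_memD(3)[OF assms])
qed

lemma charvar_red_rep_class:
  assumes "\<rho> \<in> torus_reps p q"
  shows "rep_class p q \<rho> \<in> charvar_red p q \<longleftrightarrow> abelian_image p q \<rho>"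
  using abelian_image_rep_class rep_class_self[OF assms] assms unfolding charvar_red_def by blast

lemma closedin_charvar_red: "closedin (charvar p q) (charvar_red p q)"
proof -
  interpret G: group "torus_group p q" by (rule group_torus_group)
  let ?G = "carrier (torus_group p q)"
  define k where "k g h = g \<otimes>\<^bsub>torus_group p q\<^esub> h \<otimes>\<^bsub>torus_group p q\<^esub>
     inv\<^bsub>torus_group p q\<^esub> g \<otimes>\<^bsub>torus_group p q\<^esub> inv\<^bsub>torus_group p q\<^esub> h" for g h
  have k: "k g h \<in> ?G" if "g \<in> ?G" "h \<in> ?G" for g h using that by (simp add: k_def)
  have "charvar_red p q = (\<Inter>(g, h)\<in>?G \<times> ?G. {\<xi> \<in> topspace (charvar p q). class_trace (k g h) \<xi> = 2})"
    (is "_ = ?R")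
  proof -
    have "\<xi> \<in> charvar_red p q \<longleftrightarrow> \<xi> \<in> ?R" if "\<xi> \<in> topspace (charvar p q)" for \<xi>
    proof -
      obtain \<rho> where \<rho>: "\<rho> \<in> torus_reps p q" "\<xi> = rep_class p q \<rho>"
        using \<open>\<xi> \<in> _\<close> by (auto simp: topspace_charvar)
      show ?thesis
        using that unfolding \<rho>(2) charvar_red_rep_class[OF \<rho>(1)] abelian_image_iff_trace[OF \<rho>(1)]
        by (auto simp: class_trace_rep_class[OF \<rho>(1) k] k_def [symmetric])
    qed
    moreover have "charvar_red p q \<subseteq> topspace (charvar p q)"
      by (auto simp: charvar_red_def topspace_charvar)
    moreover have "?R \<subseteq> topspace (charvar p q)"
      using G.one_closed by blast
    ultimately show ?thesis by blast
  qed
  moreover have "closedin (charvar p q) {\<xi> \<in> topspace (charvar p q). class_trace (k g h) \<xi> = 2}"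
    if "g \<in> ?G" "h \<in> ?G" for g h
    using closedin_continuous_map_preimage[OF continuous_map_class_trace[OF k[OF that]], of "{2}"] by simp
  then have "closedin (charvar p q) ?R"
    using G.one_closed by (intro closedin_Inter) auto
  ultimately show ?thesis by simp
qed

text \<open>
  On the arc, \<open>\<rho>(\<zeta>) = \<rho>(x)\<^sup>p\<close> is conjugate to \<open>diag_cis (a \<pi>)\<close>; the closure follows by continuity of
  the trace.
\<close>

lemma closure_charvar_arc_trace:
  assumes "p \<noteq> 0" "a \<le> p" "\<xi> \<in> charvar p q closure_of charvar_arc p q a b"
  shows "class_trace (torus_zeta p q) \<xi> = complex_of_real (2 * (- 1) ^ a)"
proof -
  let ?C = "{\<xi> \<in> topspace (charvar p q). class_trace (torus_zeta p q) \<xi> \<in> {complex_of_real (2 * (- 1) ^ a)}}"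
  have "charvar_arc p q a b \<subseteq> ?C"
  proof
    fix \<xi> assume "\<xi> \<in> charvar_arc p q a b"
    then obtain \<rho> where \<rho>: "\<rho> \<in> torus_reps p q" "\<xi> = rep_class p q \<rho>"
      and tr: "trace (\<rho> (torus_x p q)) = complex_of_real (2 * cos (real a * pi / real p))"
      unfolding charvar_arc_def by blast
    obtain \<sigma> \<theta> where \<sigma>: "\<sigma> \<in> rep_class p q \<rho>" "\<sigma> (torus_x p q) = diag_cis \<theta>"
      "0 \<le> \<theta>" "\<theta> \<le> pi"
      using rep_class_diagonal_at[OF \<rho>(1) torus_gens_in_carrier(1)] by blast
    have "complex_of_real (2 * cos \<theta>) = complex_of_real (2 * cos (real a * pi / real p))"
      using rep_class_memD(3)[OF \<sigma>(1) \<rho>(1) torus_gens_in_carrier(1)] tr \<sigma>(2) by simp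
    then have "cos \<theta> = cos (real a * pi / real p)" by (simp only: of_real_eq_iff)
    moreover have "0 \<le> real a * pi / real p" "real a * pi / real p \<le> pi"
      using assms(1,2) by (simp_all add: pos_divide_le_eq mult.commute)
    ultimately have "\<theta> = real a * pi / real p" using cos_inj_pi \<sigma>(3,4) by blast
    then have "cos (real p * \<theta>) = (- 1) ^ a" using assms(1) by (simp add: mult.commute)
    then have "trace (\<sigma> (torus_zeta p q)) = complex_of_real (2 * (- 1) ^ a)"
      using torus_rep_zeta[OF rep_class_memD(1)[OF \<sigma>(1) \<rho>(1)]] \<sigma>(2) by (simp add: diag_cis_pow)
    then show "\<xi> \<in> ?C"
      using \<rho> rep_class_memD(3)[OF \<sigma>(1) \<rho>(1) torus_zeta_in_carrier]
      by (simp add: class_trace_rep_class topspace_charvar)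
  qed
  moreover have "closedin (charvar p q) ?C"
    by (intro closedin_continuous_map_preimage[OF continuous_map_class_trace]) simp_all
  ultimately have "charvar p q closure_of charvar_arc p q a b \<subseteq> ?C" by (rule closure_of_minimal)
  then show ?thesis using assms(3) by auto
qed

text \<open>
  Normalized representatives of one class all have the same image of \<open>\<mu>\<close>, namely the diagonal matrix
  with the angle of the class.
\<close>

lemma peripheral_char_zetaI:
  assumes \<xi>: "\<xi> \<in> topspace (charvar p q)" and \<mu>: "\<mu> \<in> carrier (torus_group p q)"
    and "\<And>\<rho>. \<rho> \<in> torus_reps p q \<Longrightarrow> \<xi> = rep_class p q \<rho> \<Longrightarrow> \<rho> \<mu> = diag_cis (class_angle \<mu> \<xi>) \<Longrightarrow>
      \<rho> (torus_zeta p q) $ 1 $ 1 = w"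
  shows "peripheral_char p q \<mu> \<xi> (torus_zeta p q) = w"
proof -
  obtain \<rho> where \<rho>: "\<rho> \<in> torus_reps p q" "\<xi> = rep_class p q \<rho>" "\<rho> \<mu> = diag_cis (class_angle \<mu> \<xi>)"
    "0 \<le> class_angle \<mu> \<xi>" "class_angle \<mu> \<xi> \<le> pi"
    by (rule class_normalized[OF \<xi> \<mu>])
  have all: "\<sigma> (torus_zeta p q) $ 1 $ 1 = w" if \<sigma>: "\<sigma> \<in> \<xi> \<inter> normalized_reps p q \<mu>" for \<sigma>
  proof -
    have "\<sigma> \<in> torus_reps p q" "\<xi> = rep_class p q \<sigma>"
      using \<sigma> \<rho>(1) rep_class_memD[of \<sigma> p q \<rho>] unfolding \<rho>(2) by auto
    moreover obtain \<theta> where "0 \<le> \<theta>" "\<theta> \<le> pi" "\<sigma> \<mu> = diag_cis \<theta>"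
      using \<sigma> by (auto simp: normalized_reps_iff)
    ultimately show ?thesis using class_angle_eqI[of \<sigma> p q \<mu> \<theta>] \<mu> assms(3) by simp
  qed
  have "\<rho> \<in> \<xi> \<inter> normalized_reps p q \<mu>"
    using \<rho> by (auto simp: normalized_reps_iff rep_class_self)
  then have "(THE z. \<exists>\<rho>\<in>\<xi> \<inter> normalized_reps p q \<mu>. z = \<rho> (torus_zeta p q) $ 1 $ 1) = w"
    using all by (intro the_equality) (metis | blast)+
  moreover have "torus_zeta p q \<in> torus_peripheral p q \<mu>"
    unfolding torus_peripheral_def by (rule generate.incl) simp
  ultimately show ?thesis by (simp add: peripheral_char_def)
qed

lemma peripheral_char_zeta_central:
  assumes \<xi>: "\<xi> \<in> topspace (charvar p q)" and \<mu>: "\<mu> \<in> carrier (torus_group p q)"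
    and tr: "class_trace (torus_zeta p q) \<xi> = complex_of_real (2 * e)" "e = 1 \<or> e = -1"
  shows "peripheral_char p q \<mu> \<xi> (torus_zeta p q) = complex_of_real e"
proof (rule peripheral_char_zetaI[OF \<xi> \<mu>])
  fix \<rho> assume \<rho>: "\<rho> \<in> torus_reps p q" "\<xi> = rep_class p q \<rho>"
  then have "trace (\<rho> (torus_zeta p q)) = complex_of_real (2 * e)"
    using tr(1) by (simp add: class_trace_rep_class)
  then show "\<rho> (torus_zeta p q) $ 1 $ 1 = complex_of_real e"
    using SU2_eq_scalarI[OF torus_rep_in_SU2[OF \<rho>(1) torus_zeta_in_carrier] _ tr(2)] by simp
qed

text \<open>
  Because \<open>\<rho>(x)\<close> and \<open>\<rho>(y)\<close> are powers of \<open>\<rho>(\<mu>)\<close> with exponents \<open>e q\<close> and \<open>e p\<close>, the angle determines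
  an abelian representation up to conjugation and gives its value at \<open>\<zeta>\<close>.  The sign \<open>e\<close> is the
  orientation of the meridian.
\<close>

lemma charvar_red_structure:
  assumes "torus_meridian p q \<mu>"
  obtains e :: int where "\<mu> \<in> carrier (torus_group p q)" "e * e = 1"
    "\<And>\<xi>. \<xi> \<in> charvar_red p q \<Longrightarrow>
       peripheral_char p q \<mu> \<xi> (torus_zeta p q) = cis (real_of_int e * real (p * q) * class_angle \<mu> \<xi>)"
    "inj_on (class_angle \<mu>) (charvar_red p q)"
    "{0..pi} \<subseteq> class_angle \<mu> ` charvar_red p q"
proof -
  obtain s r where e: "(s * int q + r * int p) * (s * int q + r * int p) = 1"
    and \<mu>: "\<mu> \<in> carrier (torus_group p q)"
    and mer: "\<And>\<rho>. \<rho> \<in> torus_reps p q \<Longrightarrow> abelian_image p q \<rho> \<Longrightarrow>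
       \<rho> \<mu> = \<rho> (torus_x p q) [^]\<^bsub>SU2\<^esub> s ** \<rho> (torus_y p q) [^]\<^bsub>SU2\<^esub> r"
    by (rule torus_meridian_abelian[OF assms]) blast
  define e where "e = s * int q + r * int p"
  have ee: "e * e = 1" using e by (simp add: e_def)
  have gens: "\<rho> (torus_x p q) = \<rho> \<mu> [^]\<^bsub>SU2\<^esub> (e * int q)" "\<rho> (torus_y p q) = \<rho> \<mu> [^]\<^bsub>SU2\<^esub> (e * int p)"
    if "\<rho> \<in> torus_reps p q" "abelian_image p q \<rho>" for \<rho>
    using abelian_rep_gens[OF that e_def ee mer[OF that]] by simp_all
  have red: "\<xi> \<in> topspace (charvar p q)" if "\<xi> \<in> charvar_red p q" for \<xi>
    using that by (auto simp: charvar_red_def topspace_charvar)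
  show thesis
  proof (rule that[OF \<mu> ee])
    fix \<xi> assume \<xi>: "\<xi> \<in> charvar_red p q"
    show "peripheral_char p q \<mu> \<xi> (torus_zeta p q) = cis (real_of_int e * real (p * q) * class_angle \<mu> \<xi>)"
    proof (rule peripheral_char_zetaI[OF red[OF \<xi>] \<mu>])
      fix \<rho> assume \<rho>: "\<rho> \<in> torus_reps p q" "\<xi> = rep_class p q \<rho>" "\<rho> \<mu> = diag_cis (class_angle \<mu> \<xi>)"
      then have "abelian_image p q \<rho>" using \<xi> by (simp add: charvar_red_rep_class)
      then have "\<rho> (torus_zeta p q) = diag_cis (real p * (real_of_int (e * int q) * class_angle \<mu> \<xi>))"
        using \<rho> gens(1)[OF \<rho>(1)] by (simp add: torus_rep_zeta diag_cis_int_pow diag_cis_pow)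
      then show "\<rho> (torus_zeta p q) $ 1 $ 1 = cis (real_of_int e * real (p * q) * class_angle \<mu> \<xi>)"
        by (simp add: diag_cis_def mult_ac)
    qed
  next
    show "inj_on (class_angle \<mu>) (charvar_red p q)"
    proof (rule inj_onI)
      fix \<xi> \<xi>' assume \<xi>: "\<xi> \<in> charvar_red p q" "\<xi>' \<in> charvar_red p q"
        and eq: "class_angle \<mu> \<xi> = class_angle \<mu> \<xi>'"
      obtain \<rho> where \<rho>: "\<rho> \<in> torus_reps p q" "\<xi> = rep_class p q \<rho>" "\<rho> \<mu> = diag_cis (class_angle \<mu> \<xi>)"
        by (rule class_normalized[OF red[OF \<xi>(1)] \<mu>])
      obtain \<sigma> where \<sigma>: "\<sigma> \<in> torus_reps p q" "\<xi>' = rep_class p q \<sigma>" "\<sigma> \<mu> = diag_cis (class_angle \<mu> \<xi>')"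
        by (rule class_normalized[OF red[OF \<xi>(2)] \<mu>])
      have ab: "abelian_image p q \<rho>" "abelian_image p q \<sigma>"
        using \<xi> \<rho> \<sigma> by (simp_all add: charvar_red_rep_class)
      have "\<rho> \<mu> = \<sigma> \<mu>" using \<rho>(3) \<sigma>(3) eq by simp
      then have "\<rho> = \<sigma>"
        by (intro torus_rep_eqI[OF \<rho>(1) \<sigma>(1)]) (simp_all only: gens[OF \<rho>(1) ab(1)] gens[OF \<sigma>(1) ab(2)])
      then show "\<xi> = \<xi>'" using \<rho> \<sigma> by simp
    qed
  next
    show "{0..pi} \<subseteq> class_angle \<mu> ` charvar_red p q"
    proof
      fix \<theta> assume \<theta>: "\<theta> \<in> {0..pi}"
      define \<rho> where "\<rho> = diag_rep p q (real_of_int e * \<theta>)"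
      have \<rho>: "\<rho> \<in> torus_reps p q" "abelian_image p q \<rho>"
        by (simp_all add: \<rho>_def diag_rep_in_reps diag_rep_abelian)
      have "\<rho> \<mu> = diag_cis (real_of_int (e * e) * \<theta>)"
        unfolding mer[OF \<rho>] unfolding \<rho>_def diag_rep_gens diag_cis_int_pow diag_cis_mult
        by (simp add: e_def algebra_simps)
      then have "class_angle \<mu> (rep_class p q \<rho>) = \<theta>"
        using class_angle_eqI[OF \<rho>(1) \<mu>, of \<theta>] \<theta> by (simp add: ee)
      then show "\<theta> \<in> class_angle \<mu> ` charvar_red p q"
        using \<rho> charvar_red_rep_class by (metis image_eqI)
    qed
  qed
qed

text \<open>
  The cosine reverses the order on \<open>[0, \<pi>]\<close> and turns the interval of angles into the segment of
  traces.
\<close>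

lemma mem_charvar_red_part_angle:
  assumes \<mu>: "\<mu> \<in> carrier (torus_group p q)" and "0 \<le> \<alpha>" "\<alpha> < \<beta>" "\<beta> \<le> pi"
  shows "\<xi> \<in> charvar_red_part p q \<mu> (closed_segment (2 * cos \<alpha>) (2 * cos \<beta>)) \<longleftrightarrow>
    \<xi> \<in> charvar_red p q \<and> class_angle \<mu> \<xi> \<in> {\<alpha>..\<beta>}"
proof (cases "\<xi> \<in> charvar_red p q")
  case True
  then have top: "\<xi> \<in> topspace (charvar p q)" by (auto simp: charvar_red_def topspace_charvar)
  obtain \<rho> where \<rho>: "\<rho> \<in> torus_reps p q" "\<xi> = rep_class p q \<rho>" "\<rho> \<mu> = diag_cis (class_angle \<mu> \<xi>)"
    "0 \<le> class_angle \<mu> \<xi>" "class_angle \<mu> \<xi> \<le> pi"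
    by (rule class_normalized[OF top \<mu>])
  have "trace (\<sigma> \<mu>) = complex_of_real (2 * cos (class_angle \<mu> \<xi>))" if "\<sigma> \<in> \<xi>" for \<sigma>
    using rep_class_memD(3)[OF _ \<rho>(1) \<mu>, of \<sigma>] that \<rho>(2,3) by simp
  moreover have "\<rho> \<in> \<xi>" using \<rho> rep_class_self by simp
  ultimately have "(\<exists>\<sigma>\<in>\<xi>. trace (\<sigma> \<mu>) \<in> complex_of_real ` J) \<longleftrightarrow> 2 * cos (class_angle \<mu> \<xi>) \<in> J" for J
    by (auto simp: inj_image_mem_iff[OF inj_of_real] simp del: of_real_mult)
  moreover have "cos \<beta> < cos \<alpha>" using assms by (intro cos_monotone_0_pi) auto
  then have "2 * cos (class_angle \<mu> \<xi>) \<in> closed_segment (2 * cos \<alpha>) (2 * cos \<beta>)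
      \<longleftrightarrow> class_angle \<mu> \<xi> \<in> {\<alpha>..\<beta>}"
    using assms \<rho>(4,5) by (auto simp: closed_segment_eq_real_ivl cos_mono_le_eq)
  ultimately show ?thesis using True by (simp add: charvar_red_part_def)
qed (simp add: charvar_red_part_def)

section \<open>The winding number of the central element\<close>

lemma cis_sign_mult_pi:
  assumes "e * e = (1::int)"
  shows "cis (real_of_int e * (real n * pi)) = (- 1) ^ n"
proof -
  have "cis (real n * pi) = (- 1) ^ n" by (induction n) (simp_all add: distrib_right flip: cis_mult)
  moreover from this have "cis (- (real n * pi)) = (- 1) ^ n"
    by (metis cis_cnj complex_cnj_minus complex_cnj_one complex_cnj_power)
  moreover have "e = 1 \<or> e = - 1" using assms by (simp add: zmult_eq_1_iff)
  ultimately show ?thesis by auto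
qed

text \<open>
  Since \<open>c\<close> and \<open>d\<close> have the parity of \<open>a\<close>, the value at both ends of the subinterval is \<open>(-1)\<^sup>a\<close>, so
  that the loop \<open>Z\<close> closes up after \<open>(d - c) / 2\<close> turns.
\<close>

lemma torus_nu_zeta_nonzero:
  assumes pq: "p \<noteq> 0" "q \<noteq> 0" and mer: "torus_meridian p q \<mu>" and "a \<le> p"
    and c_d: "c < d" "d \<le> p * q" "even c \<longleftrightarrow> even a" "even d \<longleftrightarrow> even a"
    and \<gamma>: "pathin (charvar p q) \<gamma>" "\<gamma> 0 = \<gamma> 1" "inj_on \<gamma> {0..<1}"
      "\<gamma> ` {0..1} =
         (charvar p q closure_of charvar_arc p q a b) \<union>
         charvar_red_part p q \<mu>
           (closed_segment (2 * cos (real c * pi / real (p * q))) (2 * cos (real d * pi / real (p * q))))"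
  shows "torus_nu p q \<mu> \<gamma> (torus_zeta p q) \<noteq> 0"
proof -
  define \<alpha> \<beta> where "\<alpha> = real c * pi / real (p * q)" and "\<beta> = real d * pi / real (p * q)"
  have pq0: "real (p * q) > 0" using pq by simp
  have "\<alpha> < \<beta>" unfolding \<alpha>_def \<beta>_def using c_d(1) pq0 by (intro divide_strict_right_mono) auto
  moreover have "0 \<le> \<alpha>" by (simp add: \<alpha>_def)
  moreover have "\<beta> \<le> pi"
  proof -
    have "real d * pi \<le> real (p * q) * pi" using c_d(2) by (intro mult_right_mono) (auto simp flip: of_nat_mult)
    then show ?thesis using pq0 by (simp add: \<beta>_def field_simps)
  qed
  ultimately have ab: "0 \<le> \<alpha>" "\<alpha> < \<beta>" "\<beta> \<le> pi" by simp_all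
  obtain e :: int where \<mu>: "\<mu> \<in> carrier (torus_group p q)" and e: "e * e = 1"
    and red: "\<And>\<xi>. \<xi> \<in> charvar_red p q \<Longrightarrow>
       peripheral_char p q \<mu> \<xi> (torus_zeta p q) = cis (real_of_int e * real (p * q) * class_angle \<mu> \<xi>)"
    and inj: "inj_on (class_angle \<mu>) (charvar_red p q)"
    and onto: "{0..pi} \<subseteq> class_angle \<mu> ` charvar_red p q"
    by (rule charvar_red_structure[OF mer]) blast
  define R where "R = charvar_red_part p q \<mu> (closed_segment (2 * cos \<alpha>) (2 * cos \<beta>))"
  have R: "\<xi> \<in> R \<longleftrightarrow> \<xi> \<in> charvar_red p q \<and> class_angle \<mu> \<xi> \<in> {\<alpha>..\<beta>}" for \<xi>
    unfolding R_def by (rule mem_charvar_red_part_angle[OF \<mu> ab])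
  have im: "\<gamma> ` {0..1} = (charvar p q closure_of charvar_arc p q a b) \<union> R"
    using \<gamma>(4) by (simp add: R_def \<alpha>_def \<beta>_def)
  have cont: "continuous_map (top_of_set {0..1}) (charvar p q) \<gamma>"
    using \<gamma>(1) by (simp add: pathin_def)
  have top: "\<gamma> t \<in> topspace (charvar p q)" if "t \<in> {0..1}" for t
    using continuous_map_image_subset_topspace[OF cont] that by auto
  define f where "f t = class_angle \<mu> (\<gamma> t)" for t
  define Z where "Z t = peripheral_char p q \<mu> (\<gamma> t) (torus_zeta p q)" for t
  define T where "T = {t \<in> {0..1}. \<gamma> t \<in> R}"
  define T' where "T' = {t \<in> {0..1}. class_trace (torus_zeta p q) (\<gamma> t) = complex_of_real (2 * (- 1) ^ a)}"
  have f_cont: "continuous_on {0..1} f"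
    using continuous_map_compose[OF cont continuous_map_class_angle[OF \<mu>]]
    by (simp add: f_def[abs_def] comp_def)
  have "continuous_on {0..1} (\<lambda>t. class_trace (torus_zeta p q) (\<gamma> t))"
    using continuous_map_compose[OF cont continuous_map_class_trace[OF torus_zeta_in_carrier]]
    by (simp add: comp_def)
  then have "closed T'"
    unfolding T'_def by (intro continuous_closed_preimage_constant) auto
  have "closedin (top_of_set {0..1}) {t \<in> {0..1}. \<gamma> t \<in> charvar_red p q}"
    using closedin_continuous_map_preimage[OF cont closedin_charvar_red] by simp
  then have "closed {t \<in> {0..1}. \<gamma> t \<in> charvar_red p q}"
    by (rule closedin_closed_trans) simp
  moreover have "closed ({0..1} \<inter> f -` {\<alpha>..\<beta>})"
    using f_cont by (intro continuous_closed_preimage) auto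
  moreover have "T = {t \<in> {0..1}. \<gamma> t \<in> charvar_red p q} \<inter> ({0..1} \<inter> f -` {\<alpha>..\<beta>})"
    by (auto simp: T_def R f_def)
  ultimately have "closed T" by (simp add: closed_Int)
  have "winding_number Z 0 \<noteq> 0"
  proof (rule winding_number_loop_turn[where T = T and T' = T' and f = f and N = "real_of_int e * real (p * q)"
        and w = "(- 1) ^ a" and \<alpha> = \<alpha> and \<beta> = \<beta>])
    show "closed T" "closed T'" by fact+
    have "t \<in> T \<union> T'" if t: "t \<in> {0..1}" for t
    proof (cases "t \<in> T")
      case False
      then have "\<gamma> t \<in> charvar p q closure_of charvar_arc p q a b"
        using t im by (auto simp: T_def)
      then show ?thesis
        using closure_charvar_arc_trace[OF pq(1) \<open>a \<le> p\<close>] t by (simp add: T'_def)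
    qed simp
    moreover have "T \<union> T' \<subseteq> {0..1}" by (auto simp: T_def T'_def)
    ultimately show "T \<union> T' = {0..1}" by blast
    show "0 \<in> T \<longleftrightarrow> 1 \<in> T" "f 0 = f 1" "Z 0 = Z 1"
      using \<gamma>(2) by (simp_all add: T_def f_def Z_def)
    show "continuous_on {0..1} f" "\<alpha> < \<beta>" by fact+
    show "inj_on f (T - {1})"
    proof (rule inj_onI)
      fix t t' assume t: "t \<in> T - {1}" "t' \<in> T - {1}" "f t = f t'"
      then have "\<gamma> t = \<gamma> t'"
        using inj_onD[OF inj, of "\<gamma> t" "\<gamma> t'"] by (simp add: f_def T_def R)
      then show "t = t'" using inj_onD[OF \<gamma>(3), of t t'] t by (simp add: T_def)
    qed
    show "f ` T = {\<alpha>..\<beta>}"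
    proof
      show "f ` T \<subseteq> {\<alpha>..\<beta>}" by (auto simp: T_def R f_def)
      show "{\<alpha>..\<beta>} \<subseteq> f ` T"
      proof
        fix \<theta> assume \<theta>: "\<theta> \<in> {\<alpha>..\<beta>}"
        then have "\<theta> \<in> {0..pi}" using ab by auto
        then obtain \<xi> where "\<xi> \<in> charvar_red p q" "class_angle \<mu> \<xi> = \<theta>"
          using onto by blast
        then have "\<xi> \<in> R" using \<theta> by (simp add: R)
        then obtain t where "t \<in> {0..1}" "\<xi> = \<gamma> t" using im by (metis UnCI imageE)
        then show "\<theta> \<in> f ` T"
          using \<open>\<xi> \<in> R\<close> \<open>class_angle \<mu> \<xi> = \<theta>\<close> by (auto simp: T_def f_def)
      qed
    qed
    show "real_of_int e * real (p * q) \<noteq> 0" using pq e by auto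
    show "Z t = cis (real_of_int e * real (p * q) * f t)" if "t \<in> T" for t
      using that red by (simp add: T_def R Z_def f_def)
    have "(- 1) ^ a = (1::real) \<or> (- 1) ^ a = (- 1::real)" by (cases "even a") auto
    then show "Z t = (- 1) ^ a" if "t \<in> T'" for t
      using that peripheral_char_zeta_central[OF top \<mu>, of t "(- 1) ^ a"] by (simp add: T'_def Z_def)
    have "cis (real_of_int e * real (p * q) * (real k * pi / real (p * q))) = (- 1) ^ a"
      if "even k \<longleftrightarrow> even a" for k
    proof -
      have "cis (real_of_int e * real (p * q) * (real k * pi / real (p * q))) = cis (real_of_int e * (real k * pi))"
        using pq by simp
      also have "\<dots> = (- 1) ^ a" using that by (simp only: cis_sign_mult_pi[OF e]) (simp add: minus_one_power_iff)
      finally show ?thesis .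
    qed
    then show "cis (real_of_int e * real (p * q) * \<alpha>) = (- 1) ^ a"
      "cis (real_of_int e * real (p * q) * \<beta>) = (- 1) ^ a"
      using c_d(3,4) unfolding \<alpha>_def \<beta>_def by blast+
  qed
  then show ?thesis by (simp add: torus_nu_def Z_def[abs_def])
qed

theorem proposition5p2:
  fixes p q a b c d :: nat
    and \<mu> :: "torus_gen word set"
    and \<gamma> :: "real \<Rightarrow> torus_rep set"
  assumes "p \<ge> 2" and "q \<ge> 2" and "coprime p q"
    and "torus_meridian p q \<mu>"
    and "1 \<le> a" and "a \<le> p - 1" and "1 \<le> b" and "b \<le> q - 1" and "[a = b] (mod 2)"
    and c_d: "c \<noteq> d"
      "{c, d} = {k \<in> {1..p * q - 1}.
         ([int k = int a] (mod 2 * int p) \<or> [int k = - int a] (mod 2 * int p)) \<and>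
         ([int k = int b] (mod 2 * int q) \<or> [int k = - int b] (mod 2 * int q))}"
    and closed_curve: "pathin (charvar p q) \<gamma>" "\<gamma> 0 = \<gamma> 1" "inj_on \<gamma> {0..<1}"
      "\<gamma> ` {0..1} =
         (charvar p q closure_of charvar_arc p q a b) \<union>
         charvar_red_part p q \<mu>
           (closed_segment (2 * cos (real c * pi / real (p * q))) (2 * cos (real d * pi / real (p * q))))"
  shows "torus_nu p q \<mu> \<gamma> (torus_zeta p q) \<noteq> 0"
proof -
  have cd: "k \<le> p * q" "even k \<longleftrightarrow> even a" if "k \<in> {c, d}" for k
  proof -
    have k: "k \<in> {1..p * q - 1}" "[int k = int a] (mod 2 * int p) \<or> [int k = - int a] (mod 2 * int p)"
      using that unfolding c_d(2) by auto
    then show "k \<le> p * q" by auto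
    have "[int k = int a] (mod 2) \<or> [int k = - int a] (mod 2)"
      using k(2) cong_dvd_modulus dvd_triv_left by metis
    then have "even (int k - int a) \<or> even (int k + int a)" by (auto simp: cong_iff_dvd_diff)
    then show "even k \<longleftrightarrow> even a" by auto
  qed
  have main: ?thesis if "c' < d'" "{c', d'} = {c, d}" for c' d'
  proof (rule torus_nu_zeta_nonzero[of p q \<mu> a c' d' \<gamma> b])
    have "c' \<in> {c, d}" "d' \<in> {c, d}" using that(2) by auto
    then show "d' \<le> p * q" "even c' \<longleftrightarrow> even a" "even d' \<longleftrightarrow> even a" using cd by simp_all
    have "c' = c \<and> d' = d \<or> c' = d \<and> d' = c" using that c_d(1) by (auto simp: doubleton_eq_iff)
    then show "\<gamma> ` {0..1} =
         (charvar p q closure_of charvar_arc p q a b) \<union>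
         charvar_red_part p q \<mu>
           (closed_segment (2 * cos (real c' * pi / real (p * q))) (2 * cos (real d' * pi / real (p * q))))"
      using closed_curve(4) closed_segment_commute by metis
  qed (use assms that in auto)
  then show ?thesis using c_d(1) by (metis insert_commute linorder_neqE_nat)
qed

end
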